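(* As $n\to\infty$, the expected number $\mathbb{E}S_n$ of "old path" segments within a uniformly random plane tree of size $n$ satisfies $$\mathbb{E}S_n=\Bigl(\frac{\pi^2}{6}-1\Bigr)n-\frac{\pi^2}{36}-\frac1{12}-\frac{\pi^2}{120\,n}+O(n^{-2}).$$
   Context: A plane tree is a finite rooted tree in which the children of every node are linearly ordered (from left to right); its size is its number of nodes. An old leaf is a leaf (node without children) that is the leftmost child of its parent; the root is never an old leaf. A path is a plane tree in which every node has at most one child (including the single-node tree). For a plane tree $\tau$, $\rho(\tau)$ is the plane tree obtained by cutting all old paths, i.e. by simultaneously deleting every non-root node $v$ such that $v$ is the leftmost child of its parent and the subtree of $\tau$ consisting of $v$ and all its descendants is a path; the single-node tree is mapped to itself. Let $\tau$ be chosen uniformly at random among all plane trees of size $n$, let $X^{\blacksquare}_{n,r}$ be the number of old leaves of $\rho^r(\tau)$, and let $S_n=\sum_{r\ge0}X^{\blacksquare}_{n,r}$. *)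

theory Defs
  imports "HOL-Probability.Probability" "HOL-Library.Landau_Symbols"
begin

datatype plane_tree = Node (children: "plane_tree list")

(* The number of nodes; the generated size function of the datatype counts differently. *)
fun nodes :: "plane_tree \<Rightarrow> nat" where
  "nodes (Node ts) = 1 + sum_list (map nodes ts)"

definition trees :: "nat \<Rightarrow> plane_tree set" where
  "trees n = {t. nodes t = n}"

fun is_path :: "plane_tree \<Rightarrow> bool" where
  "is_path (Node ts) \<longleftrightarrow> length ts \<le> 1 \<and> (\<forall>t \<in> set ts. is_path t)"

(* The list head is the leftmost child. Each old leaf is counted at its parent,
   so the root never counts. *)
fun old_leaves :: "plane_tree \<Rightarrow> nat" where
  "old_leaves (Node ts) =
     (if ts \<noteq> [] \<and> hd ts = Node [] then 1 else 0) + sum_list (map old_leaves ts)"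

(* The deletions are simultaneous: whether a node is leftmost and whether its subtree
   is a path are always decided in the original tree. All proper descendants of a deleted
   node satisfy the deletion criterion too, so whole subtrees disappear. *)
fun rho :: "plane_tree \<Rightarrow> plane_tree" where
  "rho (Node []) = Node []"
| "rho (Node (t # ts)) = Node (if is_path t then map rho ts else rho t # map rho ts)"

(* Only finitely many summands are nonzero; see finite_support_old_leaves below. *)
definition old_paths :: "plane_tree \<Rightarrow> real" where
  "old_paths t = (\<Sum>r. real (old_leaves ((rho ^^ r) t)))"

(* Meaningful for n > 0, where the set of trees is finite and nonempty (see below). *)
definition expected_old_paths :: "nat \<Rightarrow> real" where
  "expected_old_paths n = measure_pmf.expectation (pmf_of_set (trees n)) old_paths"

lemma nodes_pos: "0 < nodes t"
  by (cases t) simp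

lemma finite_trees: "finite (trees n)"
proof (induction n rule: less_induct)
  case (less n)
  let ?A = "\<Union>k<n. trees k"
  have len: "length ts \<le> sum_list (map nodes ts)" for ts
  proof (induction ts)
    case (Cons t ts)
    then show ?case using nodes_pos[of t] by simp
  qed simp
  have "trees n \<subseteq> Node ` {ts. set ts \<subseteq> ?A \<and> length ts \<le> n}"
  proof
    fix t assume t: "t \<in> trees n"
    obtain ts where ts: "t = Node ts" by (cases t)
    have sum: "Suc (sum_list (map nodes ts)) = n" using t ts by (simp add: trees_def)
    have "nodes u < n" if "u \<in> set ts" for u
      using member_le_sum_list[of "nodes u" "map nodes ts"] that sum by auto
    then show "t \<in> Node ` {ts. set ts \<subseteq> ?A \<and> length ts \<le> n}"
      using ts sum len[of ts] by (auto simp: trees_def)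
  qed
  moreover have "finite {ts. set ts \<subseteq> ?A \<and> length ts \<le> n}"
    using less by (intro finite_lists_length_le) auto
  ultimately show ?case by (meson finite_imageI finite_subset)
qed

lemma trees_nonempty:
  assumes "0 < n"
  shows "trees n \<noteq> {}"
proof -
  have "nodes (Node (replicate (n - 1) (Node []))) = n"
    using assms by (simp add: sum_list_replicate)
  then show ?thesis unfolding trees_def by blast
qed

lemma nodes_rho_le: "nodes (rho t) \<le> nodes t"
proof (induction t rule: rho.induct)
  case (2 t ts)
  have "sum_list (map (nodes \<circ> rho) ts) \<le> sum_list (map nodes ts)"
    using 2 by (intro sum_list_mono) auto
  then show ?case using 2 by auto
qed simp

lemma nodes_rho_less: "t \<noteq> Node [] \<Longrightarrow> nodes (rho t) < nodes t"
proof (induction t rule: rho.induct)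
  case (2 t ts)
  have "sum_list (map (nodes \<circ> rho) ts) \<le> sum_list (map nodes ts)"
    by (intro sum_list_mono) (auto simp: nodes_rho_le)
  moreover have "\<not> is_path t \<Longrightarrow> t \<noteq> Node []" by auto
  ultimately show ?case using 2 nodes_pos[of t] by (auto simp: add_less_le_mono)
qed simp

lemma rho_funpow_nodes: "nodes t \<le> Suc r \<Longrightarrow> (rho ^^ r) t = Node []"
proof (induction r arbitrary: t)
  case 0
  then show ?case
  proof (cases t)
    case (Node ts)
    then show ?thesis using 0 nodes_pos[of "hd ts"] by (cases ts) auto
  qed
next
  case (Suc r)
  have "nodes (rho t) \<le> Suc r"
    using Suc.prems nodes_rho_less[of t] by (cases "t = Node []") auto
  then have "(rho ^^ r) (rho t) = Node []" by (rule Suc.IH)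
  then show ?case by (simp add: funpow_swap1)
qed

lemma finite_support_old_leaves:
  assumes "nodes t \<le> r"
  shows "old_leaves ((rho ^^ r) t) = 0"
  using rho_funpow_nodes[of t r] assms by simp

lemma old_paths_eq_sum: "old_paths t = (\<Sum>r<nodes t. real (old_leaves ((rho ^^ r) t)))"
  unfolding old_paths_def
  by (rule suminf_finite) (auto simp: finite_support_old_leaves)

end

theory Submission
  imports Defs "HOL-Complex_Analysis.Complex_Analysis"
begin

text \<open>
Every plane tree other than the single node arises in exactly one way from a tree \<open>l\<close> and a
tree \<open>c\<close> by making \<open>c\<close> the new last subtree of the root of \<open>l\<close>; this is \<open>graft l c\<close>.
Cutting eats a tree from the left, so \<open>c\<close> can disappear only after everything to its left has
disappeared. If the age of a tree is the number of rounds until only its root is left, it follows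
that the age of \<open>graft l c\<close> is the maximum of \<open>age l + 1\<close> and \<open>age c\<close>, and that the number
of old leaves, summed over all rounds, is additive up to one extra old leaf, which appears exactly
when \<open>age c \<le> age l\<close> (\<open>age_graft\<close>, \<open>old_paths_graft\<close>).

The recursion for the age is the one that the height satisfies when a plane tree is split into its
first subtree and the rest. Its generating functions are therefore the classical ones for bounded
height: under \<open>z = u / (1 + u)^2\<close> the trees of age at most \<open>r\<close> have the generating function
\<open>u (1 - u^(r+1)) / ((1 + u) (1 - u^(r+2)))\<close>. With Lagrange inversion the total over all trees of
size \<open>n = M + 1\<close> becomes the coefficient of \<open>u^n\<close> in
\<open>(1 - u)^2 (1 + u)^(2M)\<close> times the Lambert series \<open>\<Sum> u^k / (1 - u^k)^2\<close> over \<open>k \<ge> 2\<close>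
(\<open>sum_old_paths_eq\<close>), while the number of trees is \<open>binomial(2M, M) / n\<close>. The missing term
\<open>k = 1\<close> has the coefficient \<open>binomial(2M, M)\<close> and accounts for the \<open>- n\<close> in the expectation.

For \<open>u = exp (-t)\<close> the full Lambert series is the sum over \<open>k \<ge> 1\<close> of \<open>h (k t)\<close> with
\<open>h t = 1 / (exp t + exp (-t) - 2)\<close>. After removal of the double pole of \<open>h\<close>, Euler--Maclaurin
summation along the ray through \<open>t\<close> shows that it equals
\<open>pi^2 / (6 t^2) - 1 / (2 t) + 1 / 24\<close> up to \<open>O(|t|^4)\<close>. This holds for all complex \<open>t\<close> with
positive real part and bounded modulus, at the price of a power of \<open>|t| / Re t\<close> in the error term
(\<open>lambert_series_expansion\<close>).

The coefficient of \<open>u^n\<close> is an integral over the circle \<open>|u| = exp (-1 / sqrt n)\<close>. There the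
polynomial factor decays like a Gaussian in \<open>sqrt n * Im t\<close>, which absorbs every power of
\<open>|t| / Re t\<close>; relative to \<open>binomial(2M, M)\<close> the error term contributes only \<open>O(n^(-3))\<close>
(\<open>circle_coeff_bound\<close>). The main terms need no asymptotics at all: \<open>1 / t^2\<close> and \<open>1 / t\<close> are
first replaced by combinations of \<open>h t\<close>, \<open>1 / (exp t - 1)\<close> and \<open>exp (j t)\<close> with
\<open>|j| \<le> 2\<close> that agree with them up to \<open>O(|t|^4)\<close>, and the coefficients of those are central
binomial coefficients times explicit rational functions of \<open>n\<close> (\<open>circle_coeff_lambert_model\<close>).
Even powers of \<open>t\<close> produce the constants \<open>pi^2 / 36\<close>, \<open>1 / 12\<close> and \<open>pi^2 / 120\<close>; odd ones
contribute nothing because the coefficients of the polynomial factor are symmetric.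
\<close>

section \<open>Cutting and the last subtree of the root\<close>

definition graft :: "plane_tree \<Rightarrow> plane_tree \<Rightarrow> plane_tree" where
  "graft l c = Node (children l @ [c])"

lemma graft_not_leaf [simp]: "graft l c \<noteq> Node []"
  by (simp add: graft_def)

lemma graft_inject [simp]: "graft l c = graft l' c' \<longleftrightarrow> l = l' \<and> c = c'"
  by (cases l; cases l') (simp add: graft_def)

lemma graft_cases:
  obtains "t = Node []" | l c where "t = graft l c"
proof (cases t)
  case (Node ts)
  then show ?thesis using that
    by (cases ts rule: rev_cases) (auto simp: graft_def, metis plane_tree.sel)
qed

lemma nodes_graft [simp]: "nodes (graft l c) = nodes l + nodes c"
  by (cases l) (simp add: graft_def)

lemma is_path_graft [simp]: "is_path (graft l c) \<longleftrightarrow> l = Node [] \<and> is_path c"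
  by (cases l) (auto simp: graft_def)

text \<open>Only when \<open>l\<close> is a single node is \<open>c\<close> the leftmost child of the root, hence exposed to
deletion. In all other cases cutting acts on the two parts independently.\<close>
lemma rho_graft:
  "rho (graft l c) =
     (if l = Node [] \<and> is_path c then Node [] else graft (rho l) (rho c))"
proof (cases l)
  case (Node ts)
  then show ?thesis by (cases ts) (auto simp: graft_def)
qed

lemma is_path_iff_rho: "is_path t \<longleftrightarrow> rho t = Node []"
  by (cases t rule: graft_cases) (auto simp: rho_graft)

lemma old_leaves_graft:
  "old_leaves (graft l c) = old_leaves l + old_leaves c + of_bool (l = Node [] \<and> c = Node [])"
proof (cases l)
  case (Node ts)
  then show ?thesis by (cases ts) (auto simp: graft_def)
qed

lemma funpow_rho_leaf [simp]: "(rho ^^ r) (Node []) = Node []"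
  by (induction r) auto

text \<open>Once \<open>l\<close> has shrunk to its root, \<open>c\<close> is the leftmost child and goes in the next round if it
is a path by then, which means that this round would reduce it to a single node. This is why \<open>l\<close> is inspected one round earlier than \<open>c\<close>.\<close>
lemma funpow_rho_graft:
  "(rho ^^ r) (graft l c) =
     (if r \<ge> 1 \<and> (rho ^^ (r - 1)) l = Node [] \<and> (rho ^^ r) c = Node [] then Node []
      else graft ((rho ^^ r) l) ((rho ^^ r) c))"
proof (induction r)
  case (Suc r)
  show ?case
  proof (cases "r \<ge> 1 \<and> (rho ^^ (r - 1)) l = Node [] \<and> (rho ^^ r) c = Node []")
    case True
    then obtain s where s: "r = Suc s" by (cases r) auto
    have "(rho ^^ r) l = Node []" using True s by simp
    then show ?thesis using True Suc by simp
  next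
    case False
    then have "(rho ^^ r) (graft l c) = graft ((rho ^^ r) l) ((rho ^^ r) c)" using Suc by (simp only: if_False)
    then show ?thesis by (simp add: rho_graft is_path_iff_rho)
  qed
qed simp

definition age :: "plane_tree \<Rightarrow> nat" where
  "age t = (LEAST r. (rho ^^ r) t = Node [])"

lemma funpow_rho_eq_leaf_iff: "(rho ^^ r) t = Node [] \<longleftrightarrow> age t \<le> r"
proof
  assume "age t \<le> r"
  have "(rho ^^ age t) t = Node []"
    unfolding age_def by (rule LeastI[of _ "nodes t"], rule rho_funpow_nodes) simp
  then have "(rho ^^ (r - age t)) ((rho ^^ age t) t) = Node []" by simp
  then show "(rho ^^ r) t = Node []"
    using \<open>age t \<le> r\<close> by (metis comp_apply funpow_add le_add_diff_inverse2)
qed (auto simp: age_def intro: Least_le)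

lemma age_leaf [simp]: "age (Node []) = 0"
  using funpow_rho_eq_leaf_iff[of 0 "Node []"] by simp

lemma age_less_nodes: "age t < nodes t"
proof -
  have "(rho ^^ (nodes t - 1)) t = Node []" by (rule rho_funpow_nodes) auto
  then show ?thesis using funpow_rho_eq_leaf_iff nodes_pos[of t] by (metis Suc_pred' less_Suc_eq_le)
qed

lemma age_graft: "age (graft l c) = max (age l + 1) (age c)"
proof (rule antisym)
  have *: "age (graft l c) \<le> r \<longleftrightarrow> age l + 1 \<le> r \<and> age c \<le> r" for r
    unfolding funpow_rho_eq_leaf_iff[symmetric] funpow_rho_graft
    by (auto simp: funpow_rho_eq_leaf_iff)
  show "age (graft l c) \<le> max (age l + 1) (age c)" using * by simp
  show "max (age l + 1) (age c) \<le> age (graft l c)" using *[of "age (graft l c)"] by simp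
qed

text \<open>The extra old leaf is the root of \<open>c\<close>, in a round in which both parts consist of their roots
only and \<open>c\<close> is still attached. It is cut in the next round, so this happens at most once, in
round \<open>age l\<close>, and it requires that \<open>c\<close> is not the part that takes longer.\<close>
lemma old_leaves_funpow_rho_graft:
  "old_leaves ((rho ^^ r) (graft l c)) =
     old_leaves ((rho ^^ r) l) + old_leaves ((rho ^^ r) c) + of_bool (age c \<le> age l \<and> r = age l)"
proof (cases "r \<ge> 1 \<and> age l \<le> r - 1 \<and> age c \<le> r")
  case True
  then have "(rho ^^ r) l = Node []" "(rho ^^ r) c = Node []"
    by (auto simp: funpow_rho_eq_leaf_iff)
  moreover have "(rho ^^ r) (graft l c) = Node []"
    using True by (auto simp: funpow_rho_graft funpow_rho_eq_leaf_iff)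
  moreover have "r \<noteq> age l" using True by auto
  ultimately show ?thesis by simp
next
  case False
  then have "(rho ^^ r) (graft l c) = graft ((rho ^^ r) l) ((rho ^^ r) c)"
    by (auto simp: funpow_rho_graft funpow_rho_eq_leaf_iff)
  then show ?thesis using False by (auto simp: old_leaves_graft funpow_rho_eq_leaf_iff)
qed

lemma old_paths_eq_sum_le:
  assumes "nodes t \<le> R"
  shows "old_paths t = (\<Sum>r<R. real (old_leaves ((rho ^^ r) t)))"
  unfolding old_paths_def
  by (rule suminf_finite) (use assms in \<open>auto simp: finite_support_old_leaves\<close>)

lemma old_paths_leaf [simp]: "old_paths (Node []) = 0"
  by (simp add: old_paths_def)

lemma old_paths_graft:
  "old_paths (graft l c) = old_paths l + old_paths c + of_bool (age c \<le> age l)"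
proof -
  define R where "R = nodes l + nodes c"
  have R: "nodes l \<le> R" "nodes c \<le> R" "age l < R"
    using age_less_nodes[of l] by (auto simp: R_def)
  have "(\<Sum>r<R. of_bool (age c \<le> age l \<and> r = age l)) = (of_bool (age c \<le> age l) :: real)"
    using R(3) by (cases "age c \<le> age l") (simp_all add: of_bool_def sum.delta)
  then show ?thesis
    using old_paths_eq_sum_le[OF R(1)] old_paths_eq_sum_le[OF R(2)]
      old_paths_eq_sum_le[of "graft l c" R]
    by (simp add: R_def old_leaves_funpow_rho_graft sum.distrib)
qed

section \<open>Generating functions\<close>

lemma trees_0 [simp]: "trees 0 = {}"
  using nodes_pos by (auto simp: trees_def)

text \<open>The grafting bijection as a summation rule: this turns recursions along grafting into products
of generating functions.\<close>
lemma sum_trees_graft: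
  fixes w :: "plane_tree \<Rightarrow> 'a :: comm_monoid_add"
  shows "(\<Sum>t\<in>trees n. w t) = (if n = 1 then w (Node []) else 0) +
           (\<Sum>i=0..n. \<Sum>l\<in>trees i. \<Sum>c\<in>trees (n - i). w (graft l c))"
proof -
  define A where "A = (SIGMA i:{0..n}. trees i \<times> trees (n - i))"
  have bij: "bij_betw (\<lambda>(i, l, c). graft l c) A (trees n - {Node []})"
  proof (rule bij_betw_imageI)
    show "inj_on (\<lambda>(i, l, c). graft l c) A"
      by (auto simp: inj_on_def A_def trees_def)
    have "t \<in> (\<lambda>(i, l, c). graft l c) ` A" if "t \<in> trees n" "t \<noteq> Node []" for t
    proof (cases t rule: graft_cases)
      case (2 l c)
      then have "(nodes l, l, c) \<in> A" using that by (auto simp: A_def trees_def)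
      then show ?thesis using 2 by force
    qed (use that in auto)
    then show "(\<lambda>(i, l, c). graft l c) ` A = trees n - {Node []}"
      by (auto simp: A_def trees_def)
  qed
  have "(\<Sum>i=0..n. \<Sum>l\<in>trees i. \<Sum>c\<in>trees (n - i). w (graft l c)) =
          (\<Sum>i=0..n. \<Sum>(l, c)\<in>trees i \<times> trees (n - i). w (graft l c))"
    by (simp add: sum.cartesian_product)
  also have "\<dots> = (\<Sum>(i, l, c)\<in>A. w (graft l c))"
    unfolding A_def by (subst sum.Sigma) (auto simp: finite_trees)
  also have "\<dots> = sum w (trees n - {Node []})"
    using sum.reindex_bij_betw[OF bij, of w] by (simp add: case_prod_unfold)
  finally have *: "(\<Sum>i=0..n. \<Sum>l\<in>trees i. \<Sum>c\<in>trees (n - i). w (graft l c)) =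
                     sum w (trees n - {Node []})" .
  show ?thesis
  proof (cases "n = 1")
    case True
    then have "Node [] \<in> trees n" by (simp add: trees_def)
    then show ?thesis using True * finite_trees[of n] by (simp add: sum.remove)
  next
    case False
    then have "Node [] \<notin> trees n" by (auto simp: trees_def)
    then show ?thesis using False * by simp
  qed
qed

definition tree_gf :: "(plane_tree \<Rightarrow> complex) \<Rightarrow> complex fps" where
  "tree_gf w = Abs_fps (\<lambda>n. \<Sum>t\<in>trees n. w t)"

lemma tree_gf_nth [simp]: "tree_gf w $ n = (\<Sum>t\<in>trees n. w t)"
  by (simp add: tree_gf_def)

lemma tree_gf_mult_nth:
  "(tree_gf f * tree_gf g) $ n = (\<Sum>i=0..n. \<Sum>l\<in>trees i. \<Sum>c\<in>trees (n - i). f l * g c)"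
  by (simp add: fps_mult_nth sum_product)

lemma tree_gf_graft:
  assumes "\<And>l c. w (graft l c) = f l * g c"
  shows "tree_gf w = fps_const (w (Node [])) * fps_X + tree_gf f * tree_gf g"
  by (rule fps_ext) (subst fps_add_nth, subst tree_gf_mult_nth, simp add: sum_trees_graft[of w] assms)

definition age_le_gf :: "nat \<Rightarrow> complex fps" where
  "age_le_gf r = tree_gf (\<lambda>t. of_bool (age t \<le> r))"

definition age_eq_gf :: "nat \<Rightarrow> complex fps" where
  "age_eq_gf r = tree_gf (\<lambda>t. of_bool (age t = r))"

lemma age_le_gf_Suc: "age_le_gf (Suc r) = fps_X + age_le_gf r * age_le_gf (Suc r)"
  unfolding age_le_gf_def by (subst tree_gf_graft) (auto simp: age_graft)

lemma age_le_gf_0: "age_le_gf 0 = fps_X"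
proof (rule fps_ext)
  fix n
  have "(\<Sum>t\<in>trees n. of_bool (age t \<le> 0)) = (of_bool (n = 1) :: complex)"
    by (subst sum_trees_graft) (auto simp: age_graft)
  then show "age_le_gf 0 $ n = fps_X $ n" by (auto simp: age_le_gf_def)
qed

lemma age_eq_gf_0: "age_eq_gf 0 = age_le_gf 0"
  by (simp add: age_eq_gf_def age_le_gf_def)

lemma age_eq_gf_Suc: "age_eq_gf (Suc r) = age_le_gf (Suc r) - age_le_gf r"
  by (rule fps_ext) (auto simp: age_eq_gf_def age_le_gf_def sum_subtractf[symmetric] intro!: sum.cong)

definition all_gf :: "complex fps" where
  "all_gf = tree_gf (\<lambda>_. 1)"

lemma all_gf_eq: "all_gf = fps_X + all_gf * all_gf"
  unfolding all_gf_def by (subst tree_gf_graft[where f = "\<lambda>_. 1" and g = "\<lambda>_. 1"]) auto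

text \<open>Counts the pairs of trees whose grafting produces an extra old leaf.\<close>
definition comparison_gf :: "complex fps" where
  "comparison_gf = Abs_fps (\<lambda>n. \<Sum>i=0..n. \<Sum>l\<in>trees i. \<Sum>c\<in>trees (n - i). of_bool (age c \<le> age l))"

definition old_paths_gf :: "complex fps" where
  "old_paths_gf = tree_gf (\<lambda>t. of_real (old_paths t))"

lemma of_real_of_bool: "of_real (of_bool P) = of_bool P"
  by simp

lemma old_paths_gf_eq: "old_paths_gf = 2 * all_gf * old_paths_gf + comparison_gf"
proof (rule fps_ext)
  fix n
  have "old_paths_gf $ n = (\<Sum>i=0..n. \<Sum>l\<in>trees i. \<Sum>c\<in>trees (n - i).
           of_real (old_paths l) * 1 + 1 * of_real (old_paths c) + of_bool (age c \<le> age l))"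
    by (simp add: old_paths_gf_def sum_trees_graft[of _ n] old_paths_graft of_real_of_bool)
  also have "\<dots> = (old_paths_gf * all_gf) $ n + (all_gf * old_paths_gf) $ n + comparison_gf $ n"
    unfolding old_paths_gf_def all_gf_def tree_gf_mult_nth comparison_gf_def
    by (simp add: sum.distrib)
  finally show "old_paths_gf $ n = (2 * all_gf * old_paths_gf + comparison_gf) $ n"
    by (metis (no_types, lifting) fps_add_nth mult.commute mult.assoc mult_2)
qed

text \<open>Pairs are sorted by the age \<open>r\<close> of the first tree. A tree of size at most \<open>n\<close> has age less
than \<open>n\<close>, so that for a fixed coefficient finitely many \<open>r\<close> suffice.\<close>
lemma comparison_gf_nth:
  assumes "n \<le> R"
  shows "comparison_gf $ n = (\<Sum>r<R. age_eq_gf r * age_le_gf r) $ n"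
proof -
  have *: "of_bool (age c \<le> age l) =
             (\<Sum>r<R. of_bool (age l = r) * of_bool (age c \<le> r) :: complex)"
    if "l \<in> trees i" "i \<le> n" for l c i
  proof -
    have "age l < R" using that age_less_nodes[of l] assms by (auto simp: trees_def)
    have "(\<Sum>r<R. of_bool (age l = r) * of_bool (age c \<le> r) :: complex) =
            (\<Sum>r<R. if r = age l then of_bool (age c \<le> r) else 0)"
      by (intro sum.cong) auto
    also have "\<dots> = of_bool (age c \<le> age l)" using \<open>age l < R\<close> by simp
    finally show ?thesis by simp
  qed
  have "comparison_gf $ n = (\<Sum>i=0..n. \<Sum>l\<in>trees i. \<Sum>c\<in>trees (n - i).
          \<Sum>r<R. of_bool (age l = r) * of_bool (age c \<le> r))"
    unfolding comparison_gf_def fps_nth_Abs_fps by (intro sum.cong refl *) auto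
  also have "\<dots> = (\<Sum>i=0..n. \<Sum>l\<in>trees i. \<Sum>r<R. \<Sum>c\<in>trees (n - i).
          of_bool (age l = r) * of_bool (age c \<le> r))"
    by (subst sum.swap[of _ "{..<R}"]) simp
  also have "\<dots> = (\<Sum>i=0..n. \<Sum>r<R. \<Sum>l\<in>trees i. \<Sum>c\<in>trees (n - i).
          of_bool (age l = r) * of_bool (age c \<le> r))"
    by (subst sum.swap[of _ "{..<R}"]) simp
  also have "\<dots> = (\<Sum>r<R. \<Sum>i=0..n. \<Sum>l\<in>trees i. \<Sum>c\<in>trees (n - i).
          of_bool (age l = r) * of_bool (age c \<le> r))"
    by (subst sum.swap[of _ "{..<R}"]) simp
  also have "\<dots> = (\<Sum>r<R. age_eq_gf r * age_le_gf r) $ n"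
    unfolding age_eq_gf_def age_le_gf_def fps_sum_nth tree_gf_mult_nth ..
  finally show ?thesis .
qed

section \<open>Lagrange inversion\<close>

lemma one_plus_X_power_nth: "((1 + fps_X) ^ m :: complex fps) $ j = of_nat (m choose j)"
  by (simp add: fps_binomial_of_nat[symmetric] binomial_gbinomial)

text \<open>The substitution \<open>z = u / (1 + u)^2\<close> that makes the generating function of plane trees
rational.\<close>
definition catalan_subst :: "complex fps" where
  "catalan_subst = fps_X * inverse ((1 + fps_X)\<^sup>2)"

lemma catalan_subst_mult: "catalan_subst * (1 + fps_X)\<^sup>2 = fps_X"
proof -
  have "inverse ((1 + fps_X)\<^sup>2) * (1 + fps_X :: complex fps)\<^sup>2 = 1"
    by (rule inverse_mult_eq_1) simp
  then show ?thesis by (simp add: catalan_subst_def mult.assoc)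
qed

lemma catalan_subst_0 [simp]: "catalan_subst $ 0 = 0"
  by (simp add: catalan_subst_def)

text \<open>The coefficient of \<open>u^j\<close> in \<open>(1 - u) (1 + u)^(2j - 1)\<close> is the difference of the two equal
middle binomial coefficients. Hence the polynomial on the left extracts the \<open>n\<close>-th coefficient of
a power series in \<open>z\<close>.\<close>
lemma catalan_subst_power_mult_nth:
  assumes "n \<ge> 1" "i \<le> n"
  shows "(catalan_subst ^ i * ((1 - fps_X) * (1 + fps_X) ^ (2 * n - 1))) $ n = of_bool (i = n)"
proof (cases "i = n")
  case True
  have "catalan_subst ^ n * (1 + fps_X) ^ (2 * n) = fps_X ^ n"
    by (simp add: power_mult power_mult_distrib[symmetric] catalan_subst_mult)
  moreover have "(1 + fps_X) ^ (2 * n) = (1 + fps_X :: complex fps) * (1 + fps_X) ^ (2 * n - 1)"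
    using assms by (simp add: power_eq_if)
  ultimately have eq: "(1 + fps_X) * (catalan_subst ^ n * ((1 - fps_X) * (1 + fps_X) ^ (2 * n - 1))) =
                     fps_X ^ n * (1 - fps_X)"
    by (simp only: mult_ac)
  have "catalan_subst ^ n * ((1 - fps_X) * (1 + fps_X) ^ (2 * n - 1)) =
          inverse (1 + fps_X) * ((1 + fps_X) * (catalan_subst ^ n * ((1 - fps_X) * (1 + fps_X) ^ (2 * n - 1))))"
    by (simp add: mult.assoc[symmetric] inverse_mult_eq_1)
  also have "\<dots> = fps_X ^ n * (inverse (1 + fps_X) * (1 - fps_X))"
    unfolding eq by (simp add: mult_ac)
  finally have eq': "catalan_subst ^ n * ((1 - fps_X) * (1 + fps_X) ^ (2 * n - 1)) =
                       fps_X ^ n * (inverse (1 + fps_X) * (1 - fps_X))" .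
  show ?thesis unfolding True eq' by (simp add: fps_X_power_mult_nth)
next
  case False
  define j where "j = n - i"
  have j: "j \<ge> 1" "n = i + j" using assms False by (auto simp: j_def)
  have "(1 + fps_X) ^ (2 * n - 1) = ((1 + fps_X :: complex fps)\<^sup>2) ^ i * (1 + fps_X) ^ (2 * j - 1)"
    using j by (simp flip: power_mult power_add)
  then have "catalan_subst ^ i * ((1 - fps_X) * (1 + fps_X) ^ (2 * n - 1)) =
          (catalan_subst * (1 + fps_X)\<^sup>2) ^ i * ((1 - fps_X) * (1 + fps_X) ^ (2 * j - 1))"
    by (simp add: power_mult_distrib mult_ac)
  also have "\<dots> = fps_X ^ i * ((1 - fps_X) * (1 + fps_X) ^ (2 * j - 1))"
    by (simp add: catalan_subst_mult)
  also have "\<dots> $ n = ((1 - fps_X) * (1 + fps_X) ^ (2 * j - 1) :: complex fps) $ j"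
    using j by (simp add: fps_X_power_mult_nth)
  also have "\<dots> = of_nat ((2 * j - 1) choose j) - of_nat ((2 * j - 1) choose (j - 1))"
    using j by (simp add: left_diff_distrib one_plus_X_power_nth)
  also have "(2 * j - 1) choose j = (2 * j - 1) choose (j - 1)"
    using binomial_symmetric[of j "2 * j - 1"] j by (simp add: mult_2)
  finally show ?thesis using False by simp
qed

text \<open>Lagrange inversion for this one substitution: by linearity it suffices to know the powers
of \<open>z\<close>.\<close>
lemma lagrange_catalan_subst:
  assumes "n \<ge> 1"
  shows "G $ n = ((G oo catalan_subst) * ((1 - fps_X) * (1 + fps_X) ^ (2 * n - 1))) $ n"
proof -
  define Q :: "complex fps" where "Q = (1 - fps_X) * (1 + fps_X) ^ (2 * n - 1)"
  have *: "(G oo catalan_subst) $ j = (\<Sum>i=0..n. G $ i * (catalan_subst ^ i) $ j)" if "j \<le> n" for j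
    unfolding fps_compose_nth using that
    by (intro sum.mono_neutral_left) (auto simp: startsby_zero_power_prefix)
  have "((G oo catalan_subst) * Q) $ n = (\<Sum>j=0..n. \<Sum>i=0..n. G $ i * ((catalan_subst ^ i) $ j * Q $ (n - j)))"
    unfolding fps_mult_nth by (intro sum.cong refl) (simp add: * sum_distrib_right mult.assoc)
  also have "\<dots> = (\<Sum>i=0..n. G $ i * (catalan_subst ^ i * Q) $ n)"
    by (subst sum.swap) (simp add: fps_mult_nth sum_distrib_left)
  also have "\<dots> = (\<Sum>i=0..n. if i = n then G $ n else 0)"
    by (intro sum.cong refl) (use catalan_subst_power_mult_nth[OF assms] in \<open>auto simp: Q_def\<close>)
  finally show ?thesis by (simp add: Q_def)
qed

text \<open>The transformed series and \<open>u / (1 + u)\<close> are both roots of \<open>v = z + v^2\<close>; the other factor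
\<open>1 - \<tau> - v\<close> of their difference has the constant term 1.\<close>
lemma all_gf_subst: "(all_gf oo catalan_subst) * (1 + fps_X) = fps_X"
proof -
  define \<tau> where "\<tau> = all_gf oo catalan_subst"
  define v :: "complex fps" where "v = fps_X * inverse (1 + fps_X)"
  have v: "v * (1 + fps_X) = fps_X"
    by (simp add: v_def mult.assoc inverse_mult_eq_1)
  have \<tau>: "\<tau> = catalan_subst + \<tau> * \<tau>"
    unfolding \<tau>_def by (subst all_gf_eq) (simp add: fps_compose_add_distrib fps_compose_mult_distrib)
  have "(v - v * v) * (1 + fps_X)\<^sup>2 = v * (1 + fps_X) * (1 + fps_X) - (v * (1 + fps_X))\<^sup>2"
    by (simp add: algebra_simps power2_eq_square)
  also have "\<dots> = catalan_subst * (1 + fps_X)\<^sup>2"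
    unfolding v catalan_subst_mult by (simp add: algebra_simps power2_eq_square)
  finally have "(v - v * v) * (1 + fps_X)\<^sup>2 = catalan_subst * (1 + fps_X)\<^sup>2" .
  moreover have "(1 + fps_X :: complex fps)\<^sup>2 \<noteq> 0" using catalan_subst_mult by auto
  ultimately have "v - v * v = catalan_subst" by (metis mult_right_cancel)
  moreover have "\<tau> - \<tau> * \<tau> = catalan_subst" using \<tau> by (metis add_diff_cancel_right')
  moreover have "(\<tau> - v) * (1 - \<tau> - v) = (\<tau> - \<tau> * \<tau>) - (v - v * v)"
    by (simp add: algebra_simps)
  ultimately have "(\<tau> - v) * (1 - \<tau> - v) = 0" by simp
  moreover have "(1 - \<tau> - v) $ 0 = 1"
    by (simp add: \<tau>_def v_def all_gf_def)
  then have "1 - \<tau> - v \<noteq> 0" by (metis fps_zero_nth zero_neq_one)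
  ultimately have "\<tau> = v" by simp
  then show ?thesis using v by (simp add: \<tau>_def)
qed

lemma one_minus_X_power_nonzero: "(1 - fps_X ^ k :: complex fps) \<noteq> 0" if "k > 0"
proof -
  have "(1 - fps_X ^ k :: complex fps) $ 0 = 1" using that by (simp add: fps_power_zeroth)
  then show ?thesis by (metis fps_zero_nth zero_neq_one)
qed

text \<open>The recursion \<open>A_(r+1) = z / (1 - A_r)\<close> generates the continued fraction of the height
distribution; this closed form is its well-known solution.\<close>
lemma age_le_gf_subst:
  "(age_le_gf r oo catalan_subst) * ((1 + fps_X) * (1 - fps_X ^ (r + 2))) = fps_X * (1 - fps_X ^ (r + 1))"
proof (induction r)
  case 0
  have "(age_le_gf 0 oo catalan_subst) * ((1 + fps_X) * (1 - fps_X ^ (0 + 2))) =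
          catalan_subst * (1 + fps_X)\<^sup>2 * (1 - fps_X)"
    by (simp add: age_le_gf_0 algebra_simps power2_eq_square)
  then show ?case by (simp add: catalan_subst_mult)
next
  case (Suc r)
  define a b where "a = age_le_gf r oo catalan_subst" and "b = age_le_gf (Suc r) oo catalan_subst"
  define D :: "complex fps" where "D = (1 + fps_X) * (1 - fps_X ^ (r + 2))"
  have b: "b = catalan_subst + a * b"
    unfolding a_def b_def
    by (subst age_le_gf_Suc) (simp add: fps_compose_add_distrib fps_compose_mult_distrib)
  have aD: "a * D = fps_X * (1 - fps_X ^ (r + 1))" using Suc by (simp add: a_def D_def)
  have "b - a * b = catalan_subst" using b by (metis add_diff_cancel_right')
  moreover have "b * (D - a * D) = (b - a * b) * D" by (simp add: algebra_simps)
  ultimately have "b * (D - a * D) = catalan_subst * D" by simp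
  moreover have "D - a * D = 1 - fps_X ^ (r + 3)"
    unfolding aD by (simp add: D_def algebra_simps eval_nat_numeral)
  ultimately have "b * (1 - fps_X ^ (r + 3)) = catalan_subst * D" by simp
  then have "b * ((1 + fps_X) * (1 - fps_X ^ (r + 3))) = catalan_subst * D * (1 + fps_X)"
    by (simp add: mult_ac)
  also have "\<dots> = catalan_subst * (1 + fps_X)\<^sup>2 * (1 - fps_X ^ (r + 2))"
    by (simp add: D_def mult_ac power2_eq_square)
  also have "\<dots> = fps_X * (1 - fps_X ^ (r + 2))" by (simp add: catalan_subst_mult)
  finally show ?case by (simp add: b_def eval_nat_numeral)
qed

text \<open>The term \<open>u^k / (1 - u^k)^2 = \<Sum> m u^(k m)\<close> of the Lambert series of the divisor sum
function.\<close>
definition lambert_fps :: "nat \<Rightarrow> complex fps" where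
  "lambert_fps k = fps_X ^ k * inverse ((1 - fps_X ^ k)\<^sup>2)"

lemma lambert_fps_mult:
  assumes "k > 0"
  shows "lambert_fps k * (1 - fps_X ^ k)\<^sup>2 = fps_X ^ k"
proof -
  have "((1 - fps_X ^ k :: complex fps)\<^sup>2) $ 0 \<noteq> 0"
    using assms by (simp add: fps_power_zeroth power_0_left)
  from inverse_mult_eq_1[OF this] show ?thesis by (simp add: lambert_fps_def mult.assoc)
qed

text \<open>With \<open>p k = 1 - u^k\<close> the difference of two consecutive closed forms collapses because
\<open>(p (k - 1))^2 - p (k - 2) * p k = u^(k - 2) (1 - u)^2\<close>.\<close>
lemma age_product_subst:
  "((age_eq_gf r * age_le_gf r) oo catalan_subst) * (1 + fps_X)\<^sup>2 = (1 - fps_X)\<^sup>2 * lambert_fps (r + 2)"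
proof -
  define a where "a = (\<lambda>r. age_le_gf r oo catalan_subst)"
  define p where "p = (\<lambda>k. 1 - fps_X ^ k :: complex fps)"
  have a: "a r * ((1 + fps_X) * p (r + 2)) = fps_X * p (r + 1)" for r
    using age_le_gf_subst[of r] by (simp add: a_def p_def)
  have p: "p k \<noteq> 0" if "k > 0" for k using one_minus_X_power_nonzero that by (simp add: p_def)
  define w where "w = (age_eq_gf r * age_le_gf r) oo catalan_subst"
  have "w * (1 + fps_X)\<^sup>2 * (p (r + 2))\<^sup>2 = fps_X ^ (r + 2) * (1 - fps_X)\<^sup>2"
  proof (cases r)
    case 0
    have "w = (a 0)\<^sup>2"
      by (simp add: w_def 0 age_eq_gf_0 a_def fps_compose_mult_distrib power2_eq_square)
    then have "w * (1 + fps_X)\<^sup>2 * (p (r + 2))\<^sup>2 = (a 0 * ((1 + fps_X) * p (0 + 2)))\<^sup>2"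
      using 0 by (simp add: power_mult_distrib mult_ac)
    then show ?thesis unfolding a using 0 by (simp only: p_def power_mult_distrib add_0 power_one_right)
  next
    case (Suc s)
    have w: "w = (a (Suc s) - a s) * a (Suc s)"
      by (simp add: w_def Suc age_eq_gf_Suc a_def fps_compose_mult_distrib fps_compose_sub_distrib)
    have a1: "a (Suc s) * ((1 + fps_X) * p (s + 3)) = fps_X * p (s + 2)"
      using a[of "Suc s"] by (simp add: eval_nat_numeral)
    have a0: "a s * ((1 + fps_X) * p (s + 2)) = fps_X * p (s + 1)"
      using a[of s] .
    have "w * (1 + fps_X)\<^sup>2 * (p (s + 3))\<^sup>2 * p (s + 2) =
            (a (Suc s) * ((1 + fps_X) * p (s + 3)) * p (s + 2) - a s * ((1 + fps_X) * p (s + 2)) * p (s + 3)) *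
            (a (Suc s) * ((1 + fps_X) * p (s + 3)))"
      unfolding w by (simp add: algebra_simps power2_eq_square)
    also have "\<dots> = (fps_X * p (s + 2) * p (s + 2) - fps_X * p (s + 1) * p (s + 3)) * (fps_X * p (s + 2))"
      unfolding a1 a0 ..
    also have "fps_X * p (s + 2) * p (s + 2) - fps_X * p (s + 1) * p (s + 3) = fps_X ^ (s + 2) * (1 - fps_X)\<^sup>2"
      by (simp add: p_def algebra_simps power2_eq_square eval_nat_numeral)
    finally have "w * (1 + fps_X)\<^sup>2 * (p (s + 3))\<^sup>2 * p (s + 2) =
                    fps_X ^ (s + 3) * (1 - fps_X)\<^sup>2 * p (s + 2)"
      by (simp add: mult_ac eval_nat_numeral)
    then show ?thesis using p[of "s + 2"] Suc by (simp add: eval_nat_numeral)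
  qed
  also have "\<dots> = (1 - fps_X)\<^sup>2 * lambert_fps (r + 2) * (p (r + 2))\<^sup>2"
    using lambert_fps_mult[of "r + 2"] by (simp add: p_def mult_ac)
  finally show ?thesis using p[of "r + 2"] by (simp add: w_def)
qed

text \<open>Collects the Lagrange factor and the powers of \<open>1 - u\<close> and \<open>1 + u\<close> from the closed forms; it
carries the whole dependence on the size of the trees.\<close>
definition kernel_fps :: "nat \<Rightarrow> complex fps" where
  "kernel_fps M = (1 - fps_X)\<^sup>2 * (1 + fps_X) ^ (2 * M)"

text \<open>Solving the linear equation for the generating function of the totals divides by
\<open>1 - 2 T\<close>, which is \<open>(1 - u) / (1 + u)\<close> after the substitution. The factor \<open>1 - u\<close> cancels against
the one in the Lagrange formula.\<close>
lemma sum_old_paths_eq: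
  "(\<Sum>t\<in>trees (Suc M). complex_of_real (old_paths t)) =
     (\<Sum>r<Suc M. (kernel_fps M * lambert_fps (r + 2)) $ Suc M)"
proof -
  define n where "n = Suc M"
  define g where "g = old_paths_gf oo catalan_subst"
  define \<tau> where "\<tau> = all_gf oo catalan_subst"
  define \<beta> where "\<beta> = comparison_gf oo catalan_subst"
  define B where "B = (\<Sum>r<n. age_eq_gf r * age_le_gf r)"
  have "g = ((all_gf * old_paths_gf + all_gf * old_paths_gf) + comparison_gf) oo catalan_subst"
    unfolding g_def using old_paths_gf_eq by (metis mult_2 distrib_right)
  then have "g = \<tau> * g + \<tau> * g + \<beta>"
    by (simp only: fps_compose_add_distrib fps_compose_mult_distrib catalan_subst_0 g_def \<tau>_def \<beta>_def)
  then have "g - (\<tau> * g + \<tau> * g) = \<beta>" by (metis add_diff_cancel_left')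
  moreover have "g * (1 + fps_X - 2 * (\<tau> * (1 + fps_X))) = (g - (\<tau> * g + \<tau> * g)) * (1 + fps_X)"
    by (simp add: algebra_simps)
  ultimately have "g * (1 + fps_X - 2 * (\<tau> * (1 + fps_X))) = \<beta> * (1 + fps_X)" by simp
  then have "g * (1 + fps_X - 2 * fps_X) = \<beta> * (1 + fps_X)"
    by (simp only: \<tau>_def all_gf_subst)
  then have g: "g * (1 - fps_X) = \<beta> * (1 + fps_X)" by simp
  have "2 * n = Suc (2 * n - 1)" by (simp add: n_def)
  then have pow: "(1 + fps_X) ^ (2 * n) = (1 + fps_X :: complex fps) * (1 + fps_X) ^ (2 * n - 1)"
    by (metis power_Suc)
  have "old_paths_gf $ n = (g * ((1 - fps_X) * (1 + fps_X) ^ (2 * n - 1))) $ n"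
    unfolding g_def by (rule lagrange_catalan_subst) (simp add: n_def)
  also have "g * ((1 - fps_X) * (1 + fps_X) ^ (2 * n - 1)) = \<beta> * (1 + fps_X) ^ (2 * n)"
    unfolding pow by (simp add: mult.assoc[symmetric] g)
  also have "(\<beta> * (1 + fps_X) ^ (2 * n)) $ n = ((B oo catalan_subst) * (1 + fps_X) ^ (2 * n)) $ n"
    unfolding \<beta>_def B_def fps_mult_nth fps_compose_nth
    by (intro sum.cong refl arg_cong2[where f = "(*)"]) (auto simp: comparison_gf_nth[of _ n])
  also have "(B oo catalan_subst) * (1 + fps_X) ^ (2 * n) =
               (\<Sum>r<n. ((age_eq_gf r * age_le_gf r) oo catalan_subst) * (1 + fps_X)\<^sup>2 * (1 + fps_X) ^ (2 * M))"
  proof -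
    have pow: "(1 + fps_X) ^ (2 * n) = (1 + fps_X :: complex fps)\<^sup>2 * (1 + fps_X) ^ (2 * M)"
      by (simp add: n_def power2_eq_square)
    show ?thesis
      unfolding B_def fps_compose_sum_distrib sum_distrib_right pow by (simp only: mult.assoc)
  qed
  also have "\<dots> = (\<Sum>r<n. kernel_fps M * lambert_fps (r + 2))"
    unfolding age_product_subst by (simp add: kernel_fps_def mult_ac)
  finally show ?thesis by (simp add: old_paths_gf_def n_def fps_sum_nth)
qed

lemma Suc_times_choose_Suc: "Suc k * (n choose Suc k) = (n - k) * (n choose k)"
  by (metis binomial_absorb_comp binomial_absorption)

text \<open>The Catalan numbers, in a form without division.\<close>
lemma card_trees: "Suc M * card (trees (Suc M)) = (2 * M) choose M"
proof -
  define n where "n = Suc M"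
  have "2 * n - 1 = Suc (2 * M)" by (simp add: n_def)
  have "of_nat (card (trees n)) = all_gf $ n" by (simp add: all_gf_def)
  also have "\<dots> = ((all_gf oo catalan_subst) * ((1 - fps_X) * (1 + fps_X) ^ (2 * n - 1))) $ n"
    by (rule lagrange_catalan_subst) (simp add: n_def)
  also have "(all_gf oo catalan_subst) * ((1 - fps_X) * (1 + fps_X) ^ (2 * n - 1)) =
               (all_gf oo catalan_subst) * (1 + fps_X) * ((1 - fps_X) * (1 + fps_X) ^ (2 * M))"
    unfolding \<open>2 * n - 1 = Suc (2 * M)\<close> by (simp add: mult_ac)
  also have "\<dots> $ n = of_nat ((2 * M) choose M) - ((fps_X * (1 + fps_X) ^ (2 * M)) $ M :: complex)"
    by (simp add: all_gf_subst n_def left_diff_distrib one_plus_X_power_nth)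
  finally have c: "of_nat (card (trees n)) =
      of_nat ((2 * M) choose M) - ((fps_X * (1 + fps_X) ^ (2 * M)) $ M :: complex)" .
  show ?thesis
  proof (cases M)
    case 0
    then show ?thesis using c by (simp add: n_def)
  next
    case (Suc m)
    have "Suc m * ((2 * M) choose Suc m) = (2 * M - m) * ((2 * M) choose m)"
      by (rule Suc_times_choose_Suc)
    then have "M * ((2 * M) choose M) = Suc M * ((2 * M) choose m)"
      by (simp add: Suc)
    then have 1: "of_nat M * of_nat ((2 * M) choose M) = (of_nat (Suc M) * of_nat ((2 * M) choose m) :: complex)"
      by (metis of_nat_mult)
    have "of_nat (card (trees n)) = of_nat ((2 * M) choose M) - (of_nat ((2 * M) choose m) :: complex)"
    proof -
      have "M \<noteq> 0" "M - 1 = m" using Suc by auto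
      then have "(fps_X * (1 + fps_X) ^ (2 * M)) $ M = (of_nat ((2 * M) choose m) :: complex)"
        by (simp only: fps_X_mult_nth if_False one_plus_X_power_nth)
      then show ?thesis using c by simp
    qed
    then have "of_nat (Suc M) * of_nat (card (trees n)) =
        of_nat (Suc M) * of_nat ((2 * M) choose M) - (of_nat (Suc M) * of_nat ((2 * M) choose m) :: complex)"
      by (simp only: right_diff_distrib)
    also have "\<dots> = of_nat ((2 * M) choose M)" unfolding 1[symmetric] by (simp add: algebra_simps)
    finally show ?thesis unfolding n_def by (metis of_nat_eq_iff of_nat_mult)
  qed
qed


section \<open>Euler--Maclaurin summation of the Lambert series\<close>

text \<open>This is \<open>u / (1 - u)^2\<close> for \<open>u = exp (-z)\<close>, written symmetrically; evaluated at \<open>k t\<close> it gives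
the \<open>k\<close>-th term of the Lambert series.\<close>
definition lambert_term :: "complex \<Rightarrow> complex" where
  "lambert_term z = 1 / (exp z + exp (-z) - 2)"

lemma exp_sum_minus_2: "exp z + exp (-z) - 2 = exp (-z) * (exp z - 1)\<^sup>2" for z :: complex
  by (simp add: power2_eq_square algebra_simps exp_minus field_simps)

lemma norm_exp_minus_1_ge: "norm (exp z - 1) \<ge> exp (Re z) - 1" for z :: complex
  using norm_triangle_ineq2[of "exp z" 1] by simp

lemma exp_neq_1_if_Re_pos: "Re z > 0 \<Longrightarrow> exp z \<noteq> (1 :: complex)"
  using norm_exp_minus_1_ge[of z] by auto

text \<open>On the right of the imaginary axis the denominator is smallest on the real axis, where it equals
\<open>(2 sinh (x / 2))^2\<close>.\<close>
lemma norm_exp_sum_minus_2_ge: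
  assumes "Re z > 0"
  shows "norm (exp z + exp (-z) - 2) \<ge> (Re z)\<^sup>2"
proof -
  define x where "x = Re z"
  have x: "x > 0" using assms by (simp add: x_def)
  have "x / 2 \<le> (exp (x / 2) - inverse (exp (x / 2))) / 2"
    by (rule real_le_x_sinh) (use x in auto)
  then have "x \<le> exp (x / 2) - exp (- (x / 2))" by (simp add: exp_minus)
  then have "x\<^sup>2 \<le> (exp (x / 2) - exp (- (x / 2)))\<^sup>2"
    using x by (intro power_mono) auto
  also have "\<dots> = exp (- x) * (exp x - 1)\<^sup>2"
    by (simp add: power2_eq_square algebra_simps flip: exp_add)
  also have "\<dots> \<le> exp (- x) * (norm (exp z - 1))\<^sup>2"
    using norm_exp_minus_1_ge[of z] x by (intro mult_left_mono power_mono) (auto simp: x_def)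
  also have "\<dots> = norm (exp z + exp (-z) - 2)"
    by (simp add: exp_sum_minus_2 norm_mult norm_power x_def)
  finally show ?thesis by (simp add: x_def)
qed

lemma norm_lambert_term_le:
  assumes "Re z > 0"
  shows "norm (lambert_term z) \<le> 1 / (Re z)\<^sup>2"
  using norm_exp_sum_minus_2_ge[OF assms] assms
  by (simp add: lambert_term_def norm_divide frac_le)

lemma norm_inverse_exp_minus_1_le:
  assumes "Re z > 0"
  shows "norm (1 / (exp z - 1)) \<le> 1 / Re z"
proof -
  have "Re z \<le> norm (exp z - 1)"
    using norm_exp_minus_1_ge[of z] exp_ge_add_one_self[of "Re z"] by linarith
  then show ?thesis using assms by (simp add: norm_divide frac_le)
qed

text \<open>A domain that contains the closed rays from 0 into the right half plane and avoids the poles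
\<open>2 pi i j\<close>, \<open>j \<noteq> 0\<close>.\<close>
definition em_region :: "complex set" where
  "em_region = {z. Re z > 0} \<union> ball 0 1"

lemma open_em_region: "open em_region"
  unfolding em_region_def by (intro open_Un open_halfspace_Re_gt open_ball)

lemma exp_neq_1_on_region:
  assumes "z \<in> em_region" "z \<noteq> 0"
  shows "exp z \<noteq> 1"
proof
  assume e: "exp z = 1"
  then have z: "Re z = 0" "\<exists>n::int. Im z = of_int (2 * n) * pi" by (auto simp: exp_eq_1)
  then obtain n :: int where n: "Im z = of_int (2 * n) * pi" by auto
  have "norm z < 1" using assms z by (auto simp: em_region_def)
  then have "\<bar>Im z\<bar> < 1" using abs_Im_le_cmod[of z] by linarith
  moreover have "n \<noteq> 0" using n z assms(2) by (auto simp: complex_eq_iff)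
  then have "\<bar>of_int n :: real\<bar> \<ge> 1" by linarith
  then have "\<bar>of_int n :: real\<bar> * (2 * pi) \<ge> 1 * (2 * pi)" by (intro mult_right_mono) auto
  ultimately show False using n pi_gt3 by (simp add: abs_mult)
qed

text \<open>An antiderivative of \<open>lambert_term z - 1 / z^2\<close>, normalised to be odd. Its value at 0 is the
limit there. Since Euler--Maclaurin summation needs the integral as well as the derivatives of the
summand, everything is expressed by derivatives of this one function.\<close>
definition em_antideriv :: "complex \<Rightarrow> complex" where
  "em_antideriv z = (if z = 0 then 0 else 1 / z - 1 / 2 - 1 / (exp z - 1))"

text \<open>Both singularities at 0 are removable: first the one of \<open>(exp z - 1) / z\<close>, which does not
vanish on the domain, then the one of the difference quotient of its reciprocal.\<close>
lemma em_antideriv_extension: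
  obtains F where "F holomorphic_on em_region"
    and "\<And>z. z \<in> em_region - {0} \<Longrightarrow> F z = 1 / z - 1 / 2 - 1 / (exp z - 1)"
proof -
  define G :: "complex \<Rightarrow> complex" where
    "G = (\<lambda>z. if z = 0 then deriv exp 0 else (exp z - exp 0) / (z - 0))"
  have "G holomorphic_on em_region"
    unfolding G_def by (intro pole_lemma_open holomorphic_on_exp open_em_region)
  have "deriv exp (0 :: complex) = 1"
    using DERIV_imp_deriv[OF DERIV_exp, of 0] by simp
  then have G0: "G 0 = 1" by (simp add: G_def)
  have G: "G z = (exp z - 1) / z" if "z \<noteq> 0" for z
    using that by (simp add: G_def)
  have "G z \<noteq> 0" if "z \<in> em_region" for z
    using G0 G[of z] exp_neq_1_on_region[of z] that by (cases "z = 0") auto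
  then have H: "(\<lambda>z. 1 / G z) holomorphic_on em_region"
    using \<open>G holomorphic_on em_region\<close> by (intro holomorphic_intros) auto
  define E where "E = (\<lambda>z. if z = 0 then deriv (\<lambda>z. 1 / G z) 0 else (1 / G z - 1 / G 0) / (z - 0))"
  have "E holomorphic_on em_region"
    unfolding E_def by (intro pole_lemma_open H open_em_region)
  then have "(\<lambda>z. - E z - 1 / 2) holomorphic_on em_region" by (intro holomorphic_intros)
  moreover have "- E z - 1 / 2 = 1 / z - 1 / 2 - 1 / (exp z - 1)" if "z \<in> em_region - {0}" for z
  proof -
    have "exp z - 1 \<noteq> 0" using that exp_neq_1_on_region[of z] by simp
    then have "1 / G z = z / (exp z - 1)" using that by (simp add: G)
    then have "E z = (z / (exp z - 1) - 1) / z" using that by (simp add: E_def G0)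
    moreover have "- ((z / e - 1) / z) - 1 / 2 = 1 / z - 1 / 2 - 1 / e" if "e \<noteq> 0" "z \<noteq> 0" for e :: complex
      using that by (simp add: field_simps)
    ultimately show ?thesis using \<open>exp z - 1 \<noteq> 0\<close> that by auto
  qed
  ultimately show ?thesis using that by blast
qed

text \<open>
The Taylor coefficients at 0 are, up to the sign, Bernoulli numbers over factorials. They are found by comparing
coefficients in the identity that results from multiplying the definition by \<open>z (exp z - 1)\<close>. The
same comparison yields the value 0 at 0, and thereby holomorphy.
\<close>
lemma em_antideriv_holomorphic: "em_antideriv holomorphic_on em_region"
  and higher_deriv_em_antideriv_0:
    "(deriv ^^ 1) em_antideriv 0 = - 1 / 12"
    "(deriv ^^ 2) em_antideriv 0 = 0"
    "(deriv ^^ 3) em_antideriv 0 = 1 / 120"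
    "(deriv ^^ 4) em_antideriv 0 = 0"
proof -
  obtain F where hol: "F holomorphic_on em_region"
    and F: "\<And>z. z \<in> em_region - {0} \<Longrightarrow> F z = 1 / z - 1 / 2 - 1 / (exp z - 1)"
    using em_antideriv_extension by blast
  have 0: "0 \<in> em_region" by (simp add: em_region_def)
  define A where "A = fps_expansion F 0"
  have A: "F has_fps_expansion A"
    unfolding A_def by (rule has_fps_expansion_fps_expansion[OF open_em_region 0 hol])
  \<comment> \<open>the factor that clears the denominators of the definition\<close>
  define W :: "complex fps" where "W = fps_X * (fps_exp 1 - 1)"
  have 1: "(\<lambda>z. F z * (z * (exp z - 1))) has_fps_expansion A * W"
    unfolding W_def by (intro fps_expansion_intros A)
  have 2: "(\<lambda>z. (exp z - 1) - 1 / 2 * (z * (exp z - 1)) - z) has_fps_expansion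
                   (fps_exp 1 - 1) - fps_const (1 / 2) * W - fps_X"
    unfolding W_def by (intro fps_expansion_intros)
  have 3: "eventually (\<lambda>z. F z * (z * (exp z - 1)) = (exp z - 1) - 1 / 2 * (z * (exp z - 1)) - z) (nhds 0)"
    using eventually_nhds_in_open[OF open_em_region 0]
  proof eventually_elim
    case (elim z)
    have alg: "(1 / z - 1 / 2 - 1 / e) * (z * e) = e - 1 / 2 * (z * e) - z"
      if "z \<noteq> 0" "e \<noteq> 0" for e :: complex
      using that by (simp add: field_simps)
    show ?case
    proof (cases "z = 0")
      case False
      then have "exp z - 1 \<noteq> 0" using exp_neq_1_on_region[of z] elim by simp
      then show ?thesis using alg[OF False] F[of z] elim False by simp
    qed simp
  qed
  have eq: "A * W = (fps_exp 1 - 1) - fps_const (1 / 2) * W - fps_X"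
    by (rule fps_expansion_unique_complex[OF 1]) (use 2 has_fps_expansion_cong[OF 3 refl] in simp)
  define a w where "a = fps_nth A" and "w = fps_nth W"
  have W: "w 0 = 0" "w 1 = 0" "w 2 = 1" "w 3 = 1 / 2" "w 4 = 1 / 6" "w 5 = 1 / 24" "w 6 = 1 / 120"
    by (simp_all add: w_def W_def fact_numeral)
  define r where "r = fps_nth ((fps_exp 1 - 1) - fps_const (1 / 2) * W - fps_X)"
  have rhs: "r 2 = 0" "r 3 = - 1 / 12" "r 4 = - 1 / 24" "r 5 = - 1 / 80" "r 6 = - 1 / 360"
    by (simp_all add: r_def W[unfolded w_def] fact_numeral)
  have conv: "r 2 = a 0 * w 2 + a 1 * w 1 + a 2 * w 0"
    "r 3 = a 0 * w 3 + a 1 * w 2 + a 2 * w 1 + a 3 * w 0"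
    "r 4 = a 0 * w 4 + a 1 * w 3 + a 2 * w 2 + a 3 * w 1 + a 4 * w 0"
    "r 5 = a 0 * w 5 + a 1 * w 4 + a 2 * w 3 + a 3 * w 2 + a 4 * w 1 + a 5 * w 0"
    "r 6 = a 0 * w 6 + a 1 * w 5 + a 2 * w 4 + a 3 * w 3 + a 4 * w 2 + a 5 * w 1 + a 6 * w 0"
    unfolding r_def eq[symmetric] a_def w_def by (simp_all add: fps_mult_nth eval_nat_numeral)
  have A0: "a 0 = 0" using conv(1) by (simp add: W W[unfolded One_nat_def] rhs)
  have A1: "a 1 = - 1 / 12" using conv(2) by (simp add: W W[unfolded One_nat_def] rhs A0)
  have A2: "a 2 = 0" using conv(3) by (simp add: W W[unfolded One_nat_def] rhs A0 A1[simplified])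
  have A3: "a 3 = 1 / 720" using conv(4) by (simp add: W W[unfolded One_nat_def] rhs A0 A1[simplified] A2 field_simps)
  have A4: "a 4 = 0" using conv(5) by (simp add: W W[unfolded One_nat_def] rhs A0 A1[simplified] A2 A3 field_simps)
  have "F 0 = 0" using fps_nth_fps_expansion[OF A, of 0] A0 by (simp add: a_def)
  then have Feq: "F z = em_antideriv z" if "z \<in> em_region" for z
    using F[of z] that by (auto simp: em_antideriv_def)
  show "em_antideriv holomorphic_on em_region"
    using hol Feq holomorphic_cong by metis
  have d: "(deriv ^^ i) em_antideriv 0 = a i * fact i" for i
  proof -
    have "(deriv ^^ i) em_antideriv 0 = (deriv ^^ i) F 0"
      by (intro higher_deriv_cong_ev refl eventually_mono[OF eventually_nhds_in_open[OF open_em_region 0]])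
         (simp add: Feq)
    then show ?thesis by (simp add: a_def fps_nth_fps_expansion[OF A])
  qed
  show "(deriv ^^ 1) em_antideriv 0 = - 1 / 12" "(deriv ^^ 2) em_antideriv 0 = 0"
    "(deriv ^^ 3) em_antideriv 0 = 1 / 120" "(deriv ^^ 4) em_antideriv 0 = 0"
    unfolding d by (simp_all add: A1[simplified] A2 A3 A4 fact_numeral)
qed

abbreviation em_deriv :: "nat \<Rightarrow> complex \<Rightarrow> complex" where
  "em_deriv i \<equiv> (deriv ^^ i) em_antideriv"

lemma em_deriv_has_field_derivative:
  assumes "z \<in> em_region"
  shows "(em_deriv i has_field_derivative em_deriv (Suc i) z) (at z)"
  using holomorphic_derivI[OF holomorphic_higher_deriv[OF em_antideriv_holomorphic open_em_region]
      open_em_region assms] by simp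

lemma em_deriv_1:
  assumes "Re z > 0"
  shows "em_deriv 1 z = lambert_term z - 1 / z\<^sup>2"
proof -
  have z: "z \<noteq> 0" "exp z \<noteq> 1" using assms exp_neq_1_if_Re_pos by auto
  have "((\<lambda>z. 1 / z - 1 / 2 - 1 / (exp z - 1)) has_field_derivative
          (- 1 / z\<^sup>2 + exp z / (exp z - 1)\<^sup>2)) (at z)"
    using z by (auto intro!: derivative_eq_intros simp: power2_eq_square)
  moreover have ev: "eventually (\<lambda>w. 1 / w - 1 / 2 - 1 / (exp w - 1) = em_antideriv w) (nhds z)"
  proof -
    have "eventually (\<lambda>w. w \<in> - {0}) (nhds z)" using z by (intro eventually_nhds_in_open) auto
    then show ?thesis by eventually_elim (simp add: em_antideriv_def)
  qed
  ultimately have "(em_antideriv has_field_derivative (- 1 / z\<^sup>2 + exp z / (exp z - 1)\<^sup>2)) (at z)"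
    using DERIV_cong_ev[OF refl ev refl] by simp
  then have "em_deriv 1 z = - 1 / z\<^sup>2 + exp z / (exp z - 1)\<^sup>2"
    by (simp add: DERIV_imp_deriv)
  also have "exp z / (exp z - 1)\<^sup>2 = lambert_term z"
    unfolding lambert_term_def exp_sum_minus_2 by (simp add: exp_minus field_simps)
  finally show ?thesis by simp
qed

text \<open>Cauchy estimate on the disc of radius \<open>Re z / 2\<close>, on which both parts of the first derivative
are at most the inverse square of that radius.\<close>
lemma norm_em_deriv_le:
  assumes "Re z > 0"
  shows "norm (em_deriv (Suc m) z) \<le> 2 * fact m / (Re z / 2) ^ (m + 2)"
proof -
  define r where "r = Re z / 2"
  have r: "r > 0" using assms by (simp add: r_def)
  have half: "Re x \<ge> r" if "norm (z - x) \<le> r" for x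
    using abs_Re_le_cmod[of "z - x"] that by (simp add: r_def)
  have sub: "cball z r \<subseteq> em_region"
  proof
    fix x assume "x \<in> cball z r"
    then have "Re x \<ge> r" using half by (simp add: dist_norm)
    then show "x \<in> em_region" using r by (auto simp: em_region_def)
  qed
  have hol: "em_deriv 1 holomorphic_on em_region"
    by (rule holomorphic_higher_deriv[OF em_antideriv_holomorphic open_em_region])
  have "norm ((deriv ^^ m) (em_deriv 1) z) \<le> fact m * (2 / r\<^sup>2) / r ^ m"
  proof (rule Cauchy_inequality)
    show "em_deriv 1 holomorphic_on ball z r"
      using hol sub ball_subset_cball holomorphic_on_subset by blast
    show "continuous_on (cball z r) (em_deriv 1)"
      using hol sub holomorphic_on_imp_continuous_on holomorphic_on_subset by blast
    show "norm (em_deriv 1 x) \<le> 2 / r\<^sup>2" if "norm (z - x) = r" for x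
    proof -
      have x: "Re x \<ge> r" using half that by simp
      have "norm (em_deriv 1 x) \<le> norm (lambert_term x) + norm (1 / x\<^sup>2)"
        using em_deriv_1[of x] x r norm_triangle_ineq4[of "lambert_term x" "1 / x\<^sup>2"] by simp
      also have "norm (lambert_term x) \<le> 1 / r\<^sup>2"
      proof -
        have "norm (lambert_term x) \<le> 1 / (Re x)\<^sup>2" using norm_lambert_term_le x r by simp
        also have "\<dots> \<le> 1 / r\<^sup>2" using x r by (intro divide_left_mono power_mono) auto
        finally show ?thesis .
      qed
      also have "norm (1 / x\<^sup>2) \<le> 1 / r\<^sup>2"
      proof -
        have "r \<le> norm x" using x complex_Re_le_cmod[of x] by linarith
        then show ?thesis using r by (simp add: norm_divide norm_power frac_le power_mono)
      qed
      finally show ?thesis by simp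
    qed
  qed (fact r)
  moreover have "(deriv ^^ m) (em_deriv 1) z = em_deriv (Suc m) z"
    by (simp add: funpow_swap1)
  ultimately show ?thesis using r by (simp add: r_def power_add mult_ac power2_eq_square)
qed

text \<open>One step of the Euler--Maclaurin formula for the summand \<open>f 1\<close> with antiderivative \<open>f 0\<close>:
trapezoidal rule minus integral, corrected by the Bernoulli terms of orders 2 and 4. All Taylor
coefficients at \<open>w\<close> up to order 5 cancel, so only the remainders of order 6 survive.\<close>
lemma euler_maclaurin_cell:
  fixes f :: "nat \<Rightarrow> complex \<Rightarrow> complex"
  assumes deriv: "\<And>i x. x \<in> closed_segment w (w + t) \<Longrightarrow> i \<le> 5 \<Longrightarrow>
                    (f i has_field_derivative f (Suc i) x) (at x)"
    and bound: "\<And>x. x \<in> closed_segment w (w + t) \<Longrightarrow> norm (f 6 x) \<le> B"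
  shows "norm (t / 2 * (f 1 w + f 1 (w + t)) - (f 0 (w + t) - f 0 w)
           - t\<^sup>2 / 12 * (f 2 (w + t) - f 2 w) + t ^ 4 / 720 * (f 4 (w + t) - f 4 w)) \<le> B * norm t ^ 6"
proof -
  define T where "T m = (\<Sum>i\<le>5 - m. f (i + m) w * t ^ i / fact i)" for m
  define R where "R m = f m (w + t) - T m" for m
  have R: "norm (R m) \<le> B * norm t ^ (6 - m) / fact (5 - m)" if "m \<le> 5" for m
  proof -
    have "norm (f (0 + m) (w + t) - (\<Sum>i\<le>5 - m. f (i + m) w * (w + t - w) ^ i / fact i))
            \<le> B * norm (w + t - w) ^ Suc (5 - m) / fact (5 - m)"
    proof (rule complex_Taylor[where f = "\<lambda>i. f (i + m)" and S = "closed_segment w (w + t)"])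
      fix i x assume "x \<in> closed_segment w (w + t)" "i \<le> 5 - m"
      then show "(f (i + m) has_field_derivative f (Suc i + m) x) (at x within closed_segment w (w + t))"
        using deriv[of x "i + m"] that by (simp add: has_field_derivative_at_within)
    qed (use bound that in auto)
    moreover have "Suc (5 - m) = 6 - m" using that by simp
    ultimately show ?thesis by (simp add: R_def T_def del: power_Suc)
  qed
  have "t / 2 * (f 1 w + f 1 (w + t)) - (f 0 (w + t) - f 0 w)
           - t\<^sup>2 / 12 * (f 2 (w + t) - f 2 w) + t ^ 4 / 720 * (f 4 (w + t) - f 4 w) =
        t / 2 * R 1 - R 0 - t\<^sup>2 / 12 * R 2 + t ^ 4 / 720 * R 4"
    by (simp add: R_def T_def eval_nat_numeral atMost_Suc field_simps)
  also have "norm \<dots> \<le> norm (t / 2 * R 1) + norm (R 0) + norm (t\<^sup>2 / 12 * R 2) + norm (t ^ 4 / 720 * R 4)"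
    by (intro order.trans[OF norm_triangle_ineq] order.trans[OF norm_triangle_ineq4] add_mono order.refl)
  also have "\<dots> \<le> norm t / 2 * (B * norm t ^ 5 / 24) + B * norm t ^ 6 / 120
                  + (norm t)\<^sup>2 / 12 * (B * norm t ^ 4 / 6) + norm t ^ 4 / 720 * (B * norm t ^ 2 / 1)"
    unfolding norm_mult norm_divide norm_power
    using R[of 0] R[of 1] R[of 2] R[of 4]
    by (intro add_mono mult_mono) (auto simp: fact_numeral)
  also have "\<dots> = (1 / 48 + 1 / 120 + 1 / 72 + 1 / 720) * (B * norm t ^ 6)"
    by (simp add: field_simps eval_nat_numeral)
  also have "\<dots> \<le> 1 * (B * norm t ^ 6)"
  proof (rule mult_right_mono)
    have "B \<ge> 0" using bound[of w] norm_ge_zero order.trans by blast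
    then show "B * norm t ^ 6 \<ge> 0" by simp
  qed simp
  finally show ?thesis by simp
qed

lemma em_deriv_bounded_near_0:
  obtains C where "C > 0" "\<And>z. norm z \<le> 1 / 2 \<Longrightarrow> norm (em_deriv i z) \<le> C"
proof -
  have "em_deriv i holomorphic_on em_region"
    by (rule holomorphic_higher_deriv[OF em_antideriv_holomorphic open_em_region])
  then have "continuous_on (cball 0 (1 / 2)) (em_deriv i)"
    by (rule continuous_on_subset[OF holomorphic_on_imp_continuous_on]) (auto simp: em_region_def)
  then have "bounded (em_deriv i ` cball 0 (1 / 2))"
    by (intro compact_imp_bounded compact_continuous_image) auto
  then obtain B where "B > 0" "\<forall>z\<in>cball 0 (1 / 2). norm (em_deriv i z) \<le> B"
    by (auto simp: bounded_pos)
  then show ?thesis using that[of B] by simp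
qed

text \<open>Compactness takes care of small \<open>z\<close>, the Cauchy estimate of the others; there the real part is
replaced by the modulus with the loss of a power of \<open>\<kappa>\<close>. The resulting bound is summable along
the multiples of \<open>t\<close>.\<close>
lemma em_deriv_6_bound:
  obtains C where "C > 0"
    and "\<And>z \<kappa>. Re z > 0 \<or> z = 0 \<Longrightarrow> \<kappa> \<ge> 1 \<Longrightarrow> norm z \<le> \<kappa> * Re z \<Longrightarrow>
           norm (em_deriv 6 z) \<le> C * \<kappa> ^ 8 / (1 + norm z)\<^sup>2"
proof -
  obtain C1 where "C1 > 0" and C1: "\<And>z. norm z \<le> 1 / 2 \<Longrightarrow> norm (em_deriv 6 z) \<le> C1"
    using em_deriv_bounded_near_0[of 6] by blast
  define C where "C = max 1 (max (3 * C1) (2 * fact 5 * 2 ^ 7 * (2 ^ 5 * 9)))"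
  have "norm (em_deriv 6 z) \<le> C * \<kappa> ^ 8 / (1 + norm z)\<^sup>2"
    if z: "Re z > 0 \<or> z = 0" and \<kappa>: "\<kappa> \<ge> 1" "norm z \<le> \<kappa> * Re z" for z \<kappa>
  proof -
    have k1: "1 \<le> \<kappa> ^ 8" "\<kappa> ^ 7 \<le> \<kappa> ^ 8" using \<kappa> by (auto intro: power_increasing)
    show ?thesis
    proof (cases "norm z \<le> 1 / 2")
      case True
      have "(1 + norm z)\<^sup>2 \<le> (3 / 2)\<^sup>2" using True by (intro power_mono) auto
      then have "(1 + norm z)\<^sup>2 \<le> 3" by (simp add: power2_eq_square)
      have "norm (em_deriv 6 z) * (1 + norm z)\<^sup>2 \<le> C1 * 3"
        using C1[OF True] \<open>(1 + norm z)\<^sup>2 \<le> 3\<close> \<open>C1 > 0\<close> by (intro mult_mono) auto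
      also have "\<dots> \<le> C * 1" by (simp add: C_def)
      also have "\<dots> \<le> C * \<kappa> ^ 8" using k1 by (intro mult_left_mono) (auto simp: C_def)
      finally show ?thesis
        by (subst pos_le_divide_eq) (auto simp: zero_less_power2 add_nonneg_eq_0_iff)
    next
      case False
      then have Re: "Re z > 0" using z by auto
      have "norm z > 0" using False by linarith
      have "norm z / \<kappa> \<le> Re z" using \<kappa> by (simp add: field_simps)
      then have low: "(norm z / (2 * \<kappa>)) ^ 7 \<le> (Re z / 2) ^ 7"
        using \<kappa> by (intro power_mono) (auto simp: field_simps)
      have "norm (em_deriv 6 z) \<le> 2 * fact 5 / (Re z / 2) ^ 7"
        using norm_em_deriv_le[OF Re, of 5] by (simp add: eval_nat_numeral)
      also have "\<dots> \<le> 2 * fact 5 / (norm z / (2 * \<kappa>)) ^ 7"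
        using low \<kappa> \<open>norm z > 0\<close> Re by (intro divide_left_mono mult_pos_pos zero_less_power) auto
      also have "\<dots> = 2 * fact 5 * 2 ^ 7 * (\<kappa> ^ 7 / norm z ^ 7)"
        using \<kappa> by (simp add: power_divide power_mult_distrib)
      finally have 1: "norm (em_deriv 6 z) \<le> 2 * fact 5 * 2 ^ 7 * (\<kappa> ^ 7 / norm z ^ 7)" .
      have "(1 + norm z)\<^sup>2 \<le> (3 * norm z)\<^sup>2" using False by (intro power_mono) auto
      then have "(1 + norm z)\<^sup>2 \<le> 9 * (norm z)\<^sup>2" by (simp add: power_mult_distrib)
      moreover have "1 \<le> (2 * norm z) ^ 5" using False by (intro one_le_power) auto
      then have "1 \<le> 2 ^ 5 * norm z ^ 5" by (simp add: power_mult_distrib)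
      ultimately have "(1 + norm z)\<^sup>2 * 1 \<le> 9 * (norm z)\<^sup>2 * (2 ^ 5 * norm z ^ 5)"
        by (intro mult_mono) auto
      then have "(1 + norm z)\<^sup>2 \<le> 2 ^ 5 * 9 * norm z ^ 7"
        by (simp add: eval_nat_numeral mult_ac)
      then have "(1 + norm z)\<^sup>2 / norm z ^ 7 \<le> 2 ^ 5 * 9"
        using \<open>norm z > 0\<close> by (simp add: divide_le_eq)
      then have "\<kappa> ^ 7 * ((1 + norm z)\<^sup>2 / norm z ^ 7) \<le> \<kappa> ^ 8 * (2 ^ 5 * 9)"
        using k1 \<kappa> by (intro mult_mono) auto
      then have "2 * fact 5 * 2 ^ 7 * (\<kappa> ^ 7 * ((1 + norm z)\<^sup>2 / norm z ^ 7)) \<le>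
                   2 * fact 5 * 2 ^ 7 * (\<kappa> ^ 8 * (2 ^ 5 * 9))"
        by (intro mult_left_mono) auto
      also have "\<dots> = (2 * fact 5 * 2 ^ 7 * (2 ^ 5 * 9)) * \<kappa> ^ 8"
        by (simp only: mult_ac)
      also have "\<dots> \<le> C * \<kappa> ^ 8"
        using k1 by (intro mult_right_mono) (auto simp: C_def)
      finally have 2: "2 * fact 5 * 2 ^ 7 * (\<kappa> ^ 7 * ((1 + norm z)\<^sup>2 / norm z ^ 7)) \<le> C * \<kappa> ^ 8" .
      have "norm (em_deriv 6 z) * (1 + norm z)\<^sup>2 \<le> 2 * fact 5 * 2 ^ 7 * (\<kappa> ^ 7 / norm z ^ 7) * (1 + norm z)\<^sup>2"
        using 1 by (intro mult_right_mono) auto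
      also have "\<dots> \<le> C * \<kappa> ^ 8" using 2 by (simp add: mult_ac)
      finally show ?thesis
        by (subst pos_le_divide_eq) (auto simp: zero_less_power2 add_nonneg_eq_0_iff)
    qed
  qed
  then show ?thesis using that[of C] by (auto simp: C_def)
qed

text \<open>By comparison with the telescoping series of
\<open>1 / ((1 + k a) (1 + (k + 1) a))\<close>.\<close>
lemma sum_inverse_square_arith_le:
  fixes a :: real
  assumes "a > 0"
  shows "(\<Sum>k<K. 1 / (1 + real k * a)\<^sup>2) \<le> 1 + 1 / a"
proof -
  have "(\<Sum>k<Suc K. 1 / (1 + real k * a)\<^sup>2) \<le> 1 + 1 / a - 1 / (a * (1 + real K * a))" for K
  proof (induction K)
    case (Suc K)
    have pos: "1 + real K * a > 0" "1 + real (Suc K) * a > 0" using assms by (auto intro: add_pos_nonneg)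
    have "1 / (1 + real (Suc K) * a)\<^sup>2 \<le> 1 / ((1 + real K * a) * (1 + real (Suc K) * a))"
      unfolding power2_eq_square using pos assms
      by (intro divide_left_mono mult_right_mono mult_pos_pos) auto
    also have "\<dots> = 1 / (a * (1 + real K * a)) - 1 / (a * (1 + real (Suc K) * a))"
      using pos assms by (simp add: divide_simps) (simp add: algebra_simps)
    finally show ?case using Suc by simp
  qed simp
  from this[of K] have "(\<Sum>k<Suc K. 1 / (1 + real k * a)\<^sup>2) \<le> 1 + 1 / a"
    using assms by (smt (verit) divide_nonneg_nonneg mult_nonneg_nonneg of_nat_0_le_iff)
  moreover have "(\<Sum>k<K. 1 / (1 + real k * a)\<^sup>2) \<le> (\<Sum>k<Suc K. 1 / (1 + real k * a)\<^sup>2)" by simp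
  ultimately show ?thesis by linarith
qed

lemma ray_segment:
  assumes "x \<in> closed_segment (of_nat k * t) (of_nat k * t + t)"
  obtains a where "a \<ge> real k" "x = of_real a * t"
proof -
  obtain u where u: "0 \<le> u" "x = (1 - u) *\<^sub>R (of_nat k * t) + u *\<^sub>R (of_nat k * t + t)"
    using assms by (auto simp: in_segment)
  have "x = of_real (real k + u) * t" unfolding u(2) by (simp add: scaleR_conv_of_real algebra_simps)
  then show ?thesis using that[of "real k + u"] u(1) by simp
qed

lemma tendsto_along_ray:
  fixes g :: "complex \<Rightarrow> complex"
  assumes bound: "\<And>z. Re z > 0 \<Longrightarrow> norm (g z) \<le> c / (Re z / 2) ^ Suc j" and t: "Re t > 0"
  shows "(\<lambda>K. g (of_nat K * t)) \<longlonglongrightarrow> 0"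
proof (rule Lim_null_comparison)
  show "eventually (\<lambda>K. norm (g (of_nat K * t)) \<le> c / (Re t / 2) ^ Suc j * inverse (real K ^ Suc j)) sequentially"
    using eventually_gt_at_top[of 0]
  proof eventually_elim
    case (elim K)
    then have "Re (of_nat K * t) > 0" using t by simp
    from bound[OF this] show ?case
      by (simp add: power_mult_distrib power_divide divide_simps mult_ac)
  qed
  have "(\<lambda>K. inverse (real K ^ Suc j)) \<longlonglongrightarrow> 0"
    by (intro tendsto_inverse_0_at_top filterlim_pow_at_top filterlim_real_sequentially) auto
  from tendsto_mult_left[OF this, of "c / (Re t / 2) ^ Suc j"]
  show "(\<lambda>K. c / (Re t / 2) ^ Suc j * inverse (real K ^ Suc j)) \<longlonglongrightarrow> 0"
    by (simp only: mult_zero_right)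
qed

lemma summable_inverse_Suc_square: "summable (\<lambda>k. 1 / (real (Suc k) * a)\<^sup>2)"
proof -
  have "summable (\<lambda>k. 1 / (real (Suc k))\<^sup>2)"
    using sums_summable[OF inverse_squares_sums] by (simp add: add_ac)
  from summable_mult2[OF this, of "1 / a\<^sup>2"] show ?thesis by (simp add: power_mult_distrib)
qed

lemma summable_lambert_term:
  assumes "Re t > 0"
  shows "summable (\<lambda>k. lambert_term (of_nat (Suc k) * t))"
proof (rule summable_comparison_test)
  have "norm (lambert_term (of_nat (Suc k) * t)) \<le> 1 / (real (Suc k) * Re t)\<^sup>2" for k
    using norm_lambert_term_le[of "of_nat (Suc k) * t"] assms by (simp del: of_nat_Suc)
  then show "\<exists>N. \<forall>k\<ge>N. norm (lambert_term (of_nat (Suc k) * t)) \<le> 1 / (real (Suc k) * Re t)\<^sup>2" by blast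
qed (rule summable_inverse_Suc_square)

text \<open>Summation of the Euler--Maclaurin steps over the cells \<open>[k t, (k + 1) t]\<close>. The removed poles
add up to \<open>pi^2 / (6 t^2)\<close>, the antiderivative contributes its limit \<open>- 1 / 2\<close> at infinity, and the
half weight of the first summand contributes \<open>1 / 24\<close>; the remaining corrections at 0 vanish because
the antiderivative is odd. The parameter \<open>\<kappa>\<close> bounds the ratio of modulus and real part, which is
constant along the ray.\<close>
lemma lambert_series_expansion:
  obtains C where "C > 0"
    and "\<And>t \<kappa>. Re t > 0 \<Longrightarrow> \<kappa> \<ge> 1 \<Longrightarrow> norm t \<le> \<kappa> * Re t \<Longrightarrow> norm t \<le> 5 \<Longrightarrow>
           norm ((\<Sum>k. lambert_term (of_nat (Suc k) * t)) - (of_real (pi\<^sup>2 / 6) / t\<^sup>2 - 1 / (2 * t) + 1 / 24))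
             \<le> C * \<kappa> ^ 8 * norm t ^ 4"
proof -
  obtain C where "C > 0" and C: "\<And>z \<kappa>. Re z > 0 \<or> z = 0 \<Longrightarrow> \<kappa> \<ge> 1 \<Longrightarrow> norm z \<le> \<kappa> * Re z \<Longrightarrow>
           norm (em_deriv 6 z) \<le> C * \<kappa> ^ 8 / (1 + norm z)\<^sup>2"
    using em_deriv_6_bound by blast
  have "norm ((\<Sum>k. lambert_term (of_nat (Suc k) * t)) - (of_real (pi\<^sup>2 / 6) / t\<^sup>2 - 1 / (2 * t) + 1 / 24))
             \<le> 6 * C * \<kappa> ^ 8 * norm t ^ 4"
    if t: "Re t > 0" "norm t \<le> 5" and \<kappa>: "\<kappa> \<ge> 1" "norm t \<le> \<kappa> * Re t" for t \<kappa>
  proof -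
    have t0: "t \<noteq> 0" "norm t > 0" using t by auto
    let ?f = em_deriv
    define cell where "cell k = t / 2 * (?f 1 (of_nat k * t) + ?f 1 (of_nat k * t + t))
        - (?f 0 (of_nat k * t + t) - ?f 0 (of_nat k * t))
        - t\<^sup>2 / 12 * (?f 2 (of_nat k * t + t) - ?f 2 (of_nat k * t))
        + t ^ 4 / 720 * (?f 4 (of_nat k * t + t) - ?f 4 (of_nat k * t))" for k :: nat
    have cell: "norm (cell k) \<le> C * \<kappa> ^ 8 * norm t ^ 6 * (1 / (1 + real k * norm t)\<^sup>2)" for k
    proof -
      have "norm (cell k) \<le> C * \<kappa> ^ 8 / (1 + real k * norm t)\<^sup>2 * norm t ^ 6"
        unfolding cell_def
      proof (rule euler_maclaurin_cell)
        fix x assume x: "x \<in> closed_segment (of_nat k * t) (of_nat k * t + t)"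
        then obtain a where a: "a \<ge> real k" "x = of_real a * t" by (rule ray_segment)
        have a0: "a \<ge> 0" using a by linarith
        have x0: "Re x > 0 \<or> x = 0" using a a0 t by (cases "a = 0") auto
        then show "(?f i has_field_derivative ?f (Suc i) x) (at x)" for i
          by (intro em_deriv_has_field_derivative) (auto simp: em_region_def)
        have nx: "norm x = a * norm t" using a a0 by (simp add: norm_mult)
        have "norm x \<le> \<kappa> * Re x"
          using mult_left_mono[OF \<kappa>(2) a0] a nx by (simp add: mult_ac)
        then have "norm (?f 6 x) \<le> C * \<kappa> ^ 8 / (1 + norm x)\<^sup>2" using C x0 \<kappa> by blast
        also have "\<dots> \<le> C * \<kappa> ^ 8 / (1 + real k * norm t)\<^sup>2"
          unfolding nx using \<open>C > 0\<close> \<kappa> a t0 a0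
          by (intro divide_left_mono power_mono add_left_mono mult_right_mono mult_pos_pos zero_less_power)
             (auto intro!: add_pos_nonneg)
        finally show "norm (?f 6 x) \<le> C * \<kappa> ^ 8 / (1 + real k * norm t)\<^sup>2" .
      qed
      then show ?thesis by (simp add: mult_ac)
    qed
    have bound: "norm (\<Sum>k<K. cell k) \<le> C * \<kappa> ^ 8 * norm t ^ 6 * (1 + 1 / norm t)" for K
    proof -
      have "norm (\<Sum>k<K. cell k) \<le> (\<Sum>k<K. C * \<kappa> ^ 8 * norm t ^ 6 * (1 / (1 + real k * norm t)\<^sup>2))"
        by (intro sum_norm_le cell)
      also have "\<dots> = C * \<kappa> ^ 8 * norm t ^ 6 * (\<Sum>k<K. 1 / (1 + real k * norm t)\<^sup>2)"
        by (simp add: sum_distrib_left)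
      also have "\<dots> \<le> C * \<kappa> ^ 8 * norm t ^ 6 * (1 + 1 / norm t)"
        using sum_inverse_square_arith_le[OF t0(2), of K] \<open>C > 0\<close> \<kappa> by (intro mult_left_mono) auto
      finally show ?thesis .
    qed
    have telescope: "(\<Sum>k<K. cell k) = t * (\<Sum>k<K. ?f 1 (of_nat (Suc k) * t))
        + t / 2 * (?f 1 0 - ?f 1 (of_nat K * t)) - (?f 0 (of_nat K * t) - ?f 0 0)
        - t\<^sup>2 / 12 * (?f 2 (of_nat K * t) - ?f 2 0) + t ^ 4 / 720 * (?f 4 (of_nat K * t) - ?f 4 0)" for K
    proof (induction K)
      case (Suc K)
      have "of_nat (Suc K) * t = of_nat K * t + t" by (simp add: algebra_simps)
      then show ?case
        unfolding sum.lessThan_Suc Suc.IH cell_def[of K]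
        by (simp del: funpow.simps of_nat_Suc add: field_simps)
    qed simp
    define H where "H = (\<Sum>k. lambert_term (of_nat (Suc k) * t))"
    have "(\<lambda>k. lambert_term (of_nat (Suc k) * t)) sums H"
      unfolding H_def by (rule summable_sums[OF summable_lambert_term[OF t(1)]])
    moreover have "(\<lambda>k. of_real (1 / (real (Suc k))\<^sup>2) / t\<^sup>2) sums (of_real (pi\<^sup>2 / 6) / t\<^sup>2)"
      using inverse_squares_sums by (intro sums_divide) (simp add: add_ac sums_of_real_iff del: of_real_divide)
    ultimately have "(\<lambda>k. lambert_term (of_nat (Suc k) * t) - of_real (1 / (real (Suc k))\<^sup>2) / t\<^sup>2) sums
             (H - of_real (pi\<^sup>2 / 6) / t\<^sup>2)"
      by (rule sums_diff)
    also have "(\<lambda>k. lambert_term (of_nat (Suc k) * t) - of_real (1 / (real (Suc k))\<^sup>2) / t\<^sup>2) =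
                 (\<lambda>k. ?f 1 (of_nat (Suc k) * t))"
    proof
      fix k
      have "Re (of_nat (Suc k) * t) > 0" using t by (simp del: of_nat_Suc)
      from em_deriv_1[OF this]
      show "lambert_term (of_nat (Suc k) * t) - of_real (1 / (real (Suc k))\<^sup>2) / t\<^sup>2 = ?f 1 (of_nat (Suc k) * t)"
        by (simp add: power_mult_distrib del: of_nat_Suc)
    qed
    finally have lim0: "(\<lambda>K. \<Sum>k<K. ?f 1 (of_nat (Suc k) * t)) \<longlonglongrightarrow> H - of_real (pi\<^sup>2 / 6) / t\<^sup>2"
      by (simp add: sums_def)
    have lim_f: "(\<lambda>K. ?f (Suc m) (of_nat K * t)) \<longlonglongrightarrow> 0" for m
      by (rule tendsto_along_ray[where c = "2 * fact m" and j = "Suc m"])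
         (use norm_em_deriv_le t in \<open>simp_all del: funpow.simps power_Suc\<close>)
    have lim_F: "(\<lambda>K. ?f 0 (of_nat K * t)) \<longlonglongrightarrow> - 1 / 2"
    proof -
      have "norm (em_antideriv z + 1 / 2) \<le> 1 / (Re z / 2) ^ Suc 0" if "Re z > 0" for z
      proof -
        have "em_antideriv z + 1 / 2 = 1 / z - 1 / (exp z - 1)"
          using that by (auto simp: em_antideriv_def)
        also have "norm \<dots> \<le> norm (1 / z) + norm (1 / (exp z - 1))" by (rule norm_triangle_ineq4)
        also have "\<dots> \<le> 1 / Re z + 1 / Re z"
          using norm_inverse_exp_minus_1_le[OF that] complex_Re_le_cmod[of z] that
          by (intro add_mono) (auto simp: norm_divide frac_le)
        finally show ?thesis by simp
      qed
      from tendsto_along_ray[where g = "\<lambda>z. em_antideriv z + 1 / 2", OF this t(1)]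
      have "(\<lambda>K. em_antideriv (of_nat K * t) + 1 / 2) \<longlonglongrightarrow> 0" by simp
      from tendsto_diff[OF this tendsto_const[of "1 / 2"]] show ?thesis by simp
    qed
    have lim2: "(\<lambda>K. ?f 2 (of_nat K * t)) \<longlonglongrightarrow> 0" "(\<lambda>K. ?f 4 (of_nat K * t)) \<longlonglongrightarrow> 0"
      "(\<lambda>K. ?f 1 (of_nat K * t)) \<longlonglongrightarrow> 0"
      using lim_f[of 1] lim_f[of 3] lim_f[of 0] by (simp_all add: eval_nat_numeral)
    have "(\<lambda>K. \<Sum>k<K. cell k) \<longlonglongrightarrow>
            t * (H - of_real (pi\<^sup>2 / 6) / t\<^sup>2) + t / 2 * (?f 1 0 - 0) - (- 1 / 2 - ?f 0 0)
             - t\<^sup>2 / 12 * (0 - ?f 2 0) + t ^ 4 / 720 * (0 - ?f 4 0)"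
      unfolding telescope by (intro tendsto_intros lim0 lim2 lim_F)
    also have "?f 0 0 = 0" by (simp add: em_antideriv_def)
    also have "t * (H - of_real (pi\<^sup>2 / 6) / t\<^sup>2) + t / 2 * (?f 1 0 - 0) - (- 1 / 2 - 0)
             - t\<^sup>2 / 12 * (0 - ?f 2 0) + t ^ 4 / 720 * (0 - ?f 4 0) =
           t * (H - (of_real (pi\<^sup>2 / 6) / t\<^sup>2 - 1 / (2 * t) + 1 / 24))"
      unfolding higher_deriv_em_antideriv_0 using t0(1) by (simp add: field_simps power2_eq_square)
    finally have "norm (t * (H - (of_real (pi\<^sup>2 / 6) / t\<^sup>2 - 1 / (2 * t) + 1 / 24)))
                    \<le> C * \<kappa> ^ 8 * norm t ^ 6 * (1 + 1 / norm t)"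
      by (intro LIMSEQ_le_const2[OF tendsto_norm]) (use bound in auto)
    also have "\<dots> = norm t * (C * \<kappa> ^ 8 * norm t ^ 4 * (norm t + 1))"
      using t0 by (simp add: field_simps eval_nat_numeral)
    also have "\<dots> \<le> norm t * (C * \<kappa> ^ 8 * norm t ^ 4 * 6)"
      using t \<open>C > 0\<close> \<kappa> by (intro mult_left_mono) auto
    finally have "norm (H - (of_real (pi\<^sup>2 / 6) / t\<^sup>2 - 1 / (2 * t) + 1 / 24)) \<le> C * \<kappa> ^ 8 * norm t ^ 4 * 6"
      using t0 by (simp only: norm_mult mult_le_cancel_left_pos)
    then show ?thesis by (simp add: H_def mult_ac)
  qed
  then show ?thesis using that[of "6 * C"] \<open>C > 0\<close> by simp
qed

section \<open>Laurent approximation of the expansion at 0\<close>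

lemma em_deriv_taylor:
  assumes B: "\<And>z. norm z \<le> 1 / 2 \<Longrightarrow> norm (em_deriv (Suc n + m) z) \<le> B"
    and t: "norm t \<le> 1 / 2"
  shows "norm (em_deriv m t - (\<Sum>i\<le>n. em_deriv (i + m) 0 * t ^ i / fact i)) \<le> B * norm t ^ Suc n / fact n"
proof -
  have "norm (em_deriv (0 + m) t - (\<Sum>i\<le>n. em_deriv (i + m) 0 * (t - 0) ^ i / fact i))
          \<le> B * norm (t - 0) ^ Suc n / fact n"
  proof (rule complex_Taylor[where f = "\<lambda>i. em_deriv (i + m)" and S = "cball 0 (1 / 2)"])
    fix i x assume "x \<in> cball (0 :: complex) (1 / 2)"
    then have "x \<in> em_region" by (auto simp: em_region_def)
    from em_deriv_has_field_derivative[OF this, of "i + m"]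
    show "(em_deriv (i + m) has_field_derivative em_deriv (Suc i + m) x) (at x within cball 0 (1 / 2))"
      by (simp add: has_field_derivative_at_within)
  qed (use B t in auto)
  then show ?thesis by (simp del: power_Suc)
qed

lemma norm_linear_combination_le:
  fixes r :: complex
  shows "norm (r + a * (x - x') - b * (y - y')) \<le>
           norm r + norm a * (norm x + norm x') + norm b * (norm y + norm y')"
  by (intro order.trans[OF norm_triangle_ineq4] order.trans[OF norm_triangle_ineq] add_mono)
     (auto simp: norm_mult intro: mult_left_mono norm_triangle_ineq4)

text \<open>The difference of \<open>1 / t^2\<close> and \<open>lambert_term t\<close> is \<open>1 / 12 - t^2 / 240 + O(t^4)\<close>, and
\<open>t^2\<close> may be replaced by \<open>exp t + exp (-t) - 2\<close> within the same precision. Away from 0 every term is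
bounded by a constant times \<open>\<kappa>^2\<close>, which is enough there.\<close>
lemma inverse_square_approx:
  obtains C where "C > 0"
    and "\<And>t \<kappa>. Re t > 0 \<Longrightarrow> \<kappa> \<ge> 1 \<Longrightarrow> norm t \<le> \<kappa> * Re t \<Longrightarrow> norm t \<le> 5 \<Longrightarrow>
           norm (1 / t\<^sup>2 - (lambert_term t + 1 / 12 - (exp t + exp (-t) - 2) / 240)) \<le> C * \<kappa> ^ 8 * norm t ^ 4"
proof -
  obtain B where "B > 0" and B: "\<And>z. norm z \<le> 1 / 2 \<Longrightarrow> norm (em_deriv 5 z) \<le> B"
    using em_deriv_bounded_near_0[of 5] by blast
  define C where "C = B + exp 5 + 16 * (8 + (2 * exp 5 + 2))"
  have "norm (1 / t\<^sup>2 - (lambert_term t + 1 / 12 - (exp t + exp (-t) - 2) / 240)) \<le> C * \<kappa> ^ 8 * norm t ^ 4"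
    if t: "Re t > 0" "norm t \<le> 5" and \<kappa>: "\<kappa> \<ge> 1" "norm t \<le> \<kappa> * Re t" for t \<kappa>
  proof -
    have k1: "1 \<le> \<kappa> ^ 8" "\<kappa>\<^sup>2 \<le> \<kappa> ^ 8" using \<kappa> by (auto intro: power_increasing)
    have t0: "t \<noteq> 0" using t by auto
    show ?thesis
    proof (cases "norm t \<le> 1 / 2")
      case True
      define R1 where "R1 = em_deriv 1 t - (- 1 / 12 + t\<^sup>2 / 240)"
      have "(\<Sum>i\<le>3. em_deriv (i + 1) 0 * t ^ i / fact i) = - 1 / 12 + t\<^sup>2 / 240"
      proof -
        have sum4: "(\<Sum>i\<le>3. g i) = g 0 + g 1 + g 2 + g 3" for g :: "nat \<Rightarrow> complex"
          by (simp add: eval_nat_numeral atMost_Suc)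
        define D where "D i = em_deriv i 0" for i
        have D: "D (Suc 0) = - 1 / 12" "D 2 = 0" "D 3 = 1 / 120" "D 4 = 0"
          using higher_deriv_em_antideriv_0 unfolding D_def by simp_all
        show ?thesis unfolding D_def[symmetric] sum4 by (simp add: D D(2)[unfolded numeral_2_eq_2])
      qed
      moreover have "norm (em_deriv 1 t - (\<Sum>i\<le>3. em_deriv (i + 1) 0 * t ^ i / fact i)) \<le> B * norm t ^ Suc 3 / fact 3"
        by (rule em_deriv_taylor) (use B True in \<open>simp_all del: funpow.simps add: eval_nat_numeral\<close>)
      ultimately have R1: "norm R1 \<le> B * norm t ^ 4 / 6"
        by (simp add: R1_def fact_numeral)
      define E where "E z = exp z - (\<Sum>i\<le>3. z ^ i / fact i)" for z :: complex
      have E: "norm (E z) \<le> exp 5 * norm t ^ 4 / 6" if "norm z = norm t" for z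
      proof -
        have "norm (E z) \<le> exp (norm z) * norm z ^ Suc 3 / fact 3"
          unfolding E_def by (rule Taylor_exp_field)
        also have "\<dots> \<le> exp 5 * norm t ^ 4 / 6"
          using t that by (simp add: fact_numeral mult_right_mono)
        finally show ?thesis .
      qed
      have s: "exp t + exp (-t) - 2 = t\<^sup>2 + (E t + E (-t))"
        by (simp add: E_def eval_nat_numeral atMost_Suc)
      have "1 / t\<^sup>2 - (lambert_term t + 1 / 12 - (exp t + exp (-t) - 2) / 240) =
              - R1 + (E t + E (-t)) / 240"
      proof -
        have l: "lambert_term t = em_deriv 1 t + 1 / t\<^sup>2" using em_deriv_1[OF t(1)] by simp
        show ?thesis unfolding s l R1_def
          by (simp add: algebra_simps add_divide_distrib diff_divide_distrib del: funpow.simps)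
      qed
      also have "norm \<dots> \<le> norm R1 + (norm (E t) + norm (E (-t))) / 240"
        by (rule order.trans[OF norm_triangle_ineq])
           (simp add: norm_divide norm_triangle_ineq divide_right_mono)
      also have "\<dots> \<le> (B / 6 + exp 5 / 720) * norm t ^ 4"
      proof -
        have "r + (e + e') / 240 \<le> b / 6 + x / 720" if "r \<le> b / 6" "e \<le> x / 6" "e' \<le> x / 6" for r e e' b x :: real
          using that by argo
        from this[OF R1 E E, of t "-t"] show ?thesis by (simp add: distrib_right)
      qed
      also have "\<dots> \<le> (C * \<kappa> ^ 8) * norm t ^ 4"
      proof (rule mult_right_mono)
        have "b / 6 + e / 720 \<le> (b + e + 16 * (8 + (2 * e + 2))) * 1" if "b > 0" "e > 0" for b e :: real
          using that by argo
        from this[of B "exp 5"] have "B / 6 + exp 5 / 720 \<le> C * 1" using \<open>B > 0\<close> by (simp add: C_def)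
        also have "\<dots> \<le> C * \<kappa> ^ 8" using k1 \<open>B > 0\<close>
          by (intro mult_left_mono) (auto simp: C_def intro!: add_nonneg_nonneg)
        finally show "B / 6 + exp 5 / 720 \<le> C * \<kappa> ^ 8" .
      qed simp
      finally show ?thesis .
    next
      case False
      have t4: "1 \<le> 16 * norm t ^ 4"
        using power_mono[of 1 "2 * norm t" 4] False by (simp add: power_mult_distrib)
      have "norm (1 / t\<^sup>2) \<le> 4"
        using power_mono[of 1 "2 * norm t" 2] False by (simp add: norm_divide norm_power power_mult_distrib divide_le_eq)
      have "1 \<le> \<kappa> * (2 * Re t)" using \<kappa> False by linarith
      then have "1 \<le> (\<kappa> * (2 * Re t))\<^sup>2" by (intro one_le_power)
      then have "1 / (Re t)\<^sup>2 \<le> 4 * \<kappa>\<^sup>2"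
        using t by (simp add: divide_le_eq power_mult_distrib mult_ac)
      then have h: "norm (lambert_term t) \<le> 4 * \<kappa> ^ 8"
        using norm_lambert_term_le[OF t(1)] k1 by linarith
      have e: "norm (exp t) \<le> exp 5" "norm (exp (-t)) \<le> exp 5"
        using t complex_Re_le_cmod[of t] by auto
      have s: "norm (exp t + exp (-t) - 2) \<le> 2 * exp 5 + 2"
        using norm_triangle_ineq4[of "exp t + exp (-t)" 2] norm_triangle_ineq[of "exp t" "exp (-t)"] e
        by (simp only: norm_numeral)
      have "norm (1 / t\<^sup>2 - (lambert_term t + 1 / 12 - (exp t + exp (-t) - 2) / 240)) \<le>
              norm (1 / t\<^sup>2) + (norm (lambert_term t) + norm (1 / 12 :: complex) + norm ((exp t + exp (-t) - 2) / 240))"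
        by (intro order.trans[OF norm_triangle_ineq4] add_left_mono order.trans[OF norm_triangle_ineq] add_right_mono order.refl)
      also have "\<dots> \<le> 4 + (4 * \<kappa> ^ 8 + 1 / 12 + (2 * exp 5 + 2) / 240)"
        using \<open>norm (1 / t\<^sup>2) \<le> 4\<close> h s by (intro add_mono) (auto simp: norm_divide)
      also have "\<dots> \<le> (8 + (2 * exp 5 + 2)) * \<kappa> ^ 8"
      proof -
        have "(2 * exp 5 + 2) * 1 \<le> (2 * exp 5 + 2 :: real) * \<kappa> ^ 8"
          using k1 by (intro mult_left_mono) auto
        then have le: "2 * exp 5 + 2 \<le> (2 * exp 5 + 2 :: real) * \<kappa> ^ 8" by simp
        have "4 + (4 * k + 1 / 12 + e / 240) \<le> 8 * k + f" if "k \<ge> 1" "e \<le> f" "e \<ge> 2" for k e f :: real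
          using that by argo
        from this[OF k1(1) le] show ?thesis by (simp only: distrib_right[of 8]) simp
      qed
      also have "\<dots> \<le> (8 + (2 * exp 5 + 2)) * \<kappa> ^ 8 * (16 * norm t ^ 4)"
        using mult_left_mono[OF t4, of "(8 + (2 * exp 5 + 2)) * \<kappa> ^ 8"] k1 by simp
      also have "\<dots> = (16 * (8 + (2 * exp 5 + 2))) * (\<kappa> ^ 8 * norm t ^ 4)" by (simp only: mult_ac)
      also have "\<dots> \<le> C * (\<kappa> ^ 8 * norm t ^ 4)"
        using \<open>B > 0\<close> k1 by (intro mult_right_mono) (auto simp: C_def)
      finally show ?thesis by (simp add: mult_ac)
    qed
  qed
  moreover have "C > 0" using \<open>B > 0\<close> by (simp add: C_def add_pos_pos)
  ultimately show ?thesis using that[of C] by blast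
qed

text \<open>Here \<open>1 / t - (1 / 2 + 1 / (exp t - 1))\<close> equals \<open>- t / 12 + t^3 / 720 + O(t^5)\<close>. The weights
\<open>41 / 720\<close> and \<open>11 / 1440\<close> are the solution of the two linear equations that express this cubic by
\<open>exp t - exp (-t)\<close> and \<open>exp (2 t) - exp (-2 t)\<close>.\<close>
lemma inverse_approx:
  obtains C where "C > 0"
    and "\<And>t \<kappa>. Re t > 0 \<Longrightarrow> \<kappa> \<ge> 1 \<Longrightarrow> norm t \<le> \<kappa> * Re t \<Longrightarrow> norm t \<le> 5 \<Longrightarrow>
           norm (1 / t - (1 / 2 + 1 / (exp t - 1) - 41 / 720 * (exp t - exp (-t))
                    + 11 / 1440 * (exp (2 * t) - exp (- 2 * t)))) \<le> C * \<kappa> ^ 8 * norm t ^ 4"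
proof -
  obtain B where "B > 0" and B: "\<And>z. norm z \<le> 1 / 2 \<Longrightarrow> norm (em_deriv 5 z) \<le> B"
    using em_deriv_bounded_near_0[of 5] by blast
  define C where "C = B + 64 * exp 10 + 16 * (5 + 4 * exp 10)"
  have "norm (1 / t - (1 / 2 + 1 / (exp t - 1) - 41 / 720 * (exp t - exp (-t))
                    + 11 / 1440 * (exp (2 * t) - exp (- 2 * t)))) \<le> C * \<kappa> ^ 8 * norm t ^ 4"
    if t: "Re t > 0" "norm t \<le> 5" and \<kappa>: "\<kappa> \<ge> 1" "norm t \<le> \<kappa> * Re t" for t \<kappa>
  proof -
    have k1: "1 \<le> \<kappa> ^ 8" "\<kappa> \<le> \<kappa> ^ 8" using \<kappa> by (auto intro: self_le_power)
    have t0: "t \<noteq> 0" using t by auto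
    show ?thesis
    proof (cases "norm t \<le> 1 / 2")
      case True
      define R1 where "R1 = em_antideriv t - (- t / 12 + t ^ 3 / 720)"
      have "(\<Sum>i\<le>4. em_deriv (i + 0) 0 * t ^ i / fact i) = - t / 12 + t ^ 3 / 720"
      proof -
        have sum5: "(\<Sum>i\<le>4. g i) = g 0 + g 1 + g 2 + g 3 + g 4" for g :: "nat \<Rightarrow> complex"
          by (simp add: eval_nat_numeral atMost_Suc)
        define D where "D i = em_deriv i 0" for i
        have D: "D 0 = 0" "D (Suc 0) = - 1 / 12" "D 2 = 0" "D 3 = 1 / 120" "D 4 = 0"
          using higher_deriv_em_antideriv_0 unfolding D_def by (simp_all add: em_antideriv_def)
        show ?thesis unfolding D_def[symmetric] sum5 by (simp add: D fact_numeral)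
      qed
      moreover have "norm (em_deriv 0 t - (\<Sum>i\<le>4. em_deriv (i + 0) 0 * t ^ i / fact i)) \<le> B * norm t ^ Suc 4 / fact 4"
        by (rule em_deriv_taylor) (use B True in \<open>simp_all del: funpow.simps add: eval_nat_numeral\<close>)
      ultimately have R1: "norm R1 \<le> B * norm t ^ 5 / 24"
        by (simp add: R1_def fact_numeral)
      define E where "E z = exp z - (\<Sum>i\<le>4. z ^ i / fact i)" for z :: complex
      have E: "norm (E z) \<le> exp 10 * (32 * norm t ^ 5) / 24" if "norm z \<le> 2 * norm t" for z
      proof -
        have "norm (E z) \<le> exp (norm z) * norm z ^ Suc 4 / fact 4"
          unfolding E_def by (rule Taylor_exp_field)
        also have "\<dots> \<le> exp 10 * (2 * norm t) ^ Suc 4 / fact 4"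
          using t that by (intro divide_right_mono mult_mono power_mono) auto
        finally show ?thesis by (simp add: fact_numeral power_mult_distrib)
      qed
      have s1: "exp t - exp (-t) = 2 * t + t ^ 3 / 3 + (E t - E (-t))"
        by (simp add: E_def eval_nat_numeral atMost_Suc)
      have s2: "exp (2 * t) - exp (- 2 * t) = 4 * t + 8 * t ^ 3 / 3 + (E (2 * t) - E (- 2 * t))"
        by (simp add: E_def eval_nat_numeral atMost_Suc)
      have "1 / t - (1 / 2 + 1 / (exp t - 1) - 41 / 720 * (exp t - exp (-t))
                    + 11 / 1440 * (exp (2 * t) - exp (- 2 * t))) =
              em_antideriv t + 41 / 720 * (exp t - exp (-t)) - 11 / 1440 * (exp (2 * t) - exp (- 2 * t))"
        using t0 by (simp add: em_antideriv_def algebra_simps)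
      also have "\<dots> = R1 + 41 / 720 * (E t - E (-t)) - 11 / 1440 * (E (2 * t) - E (- 2 * t))"
        unfolding s1 s2 by (simp add: R1_def field_simps)
      also have "norm \<dots> \<le> norm R1 + 41 / 720 * (norm (E t) + norm (E (-t)))
                             + 11 / 1440 * (norm (E (2 * t)) + norm (E (- 2 * t)))"
        using norm_linear_combination_le[of R1 "41 / 720" "E t" "E (-t)" "11 / 1440" "E (2 * t)" "E (- 2 * t)"]
        by (simp only: norm_divide norm_numeral)
      also have "\<dots> \<le> (B + 64 * exp 10) * norm t ^ 5"
      proof -
        have "r + 41 / 720 * (e1 + e2) + 11 / 1440 * (e3 + e4) \<le> b + 64 * x"
          if "r \<le> b / 24" "b \<ge> 0" "x \<ge> 0" "e1 \<le> 32 * x / 24" "e2 \<le> 32 * x / 24" "e3 \<le> 32 * x / 24" "e4 \<le> 32 * x / 24"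
          for r e1 e2 e3 e4 b x :: real
          using that by argo
        from this[of "norm R1" "B * norm t ^ 5" "exp 10 * norm t ^ 5" "norm (E t)" "norm (E (-t))"
            "norm (E (2 * t))" "norm (E (- 2 * t))"]
        show ?thesis
          using R1 E[of t] E[of "-t"] E[of "2 * t"] E[of "- 2 * t"] \<open>B > 0\<close>
          by (simp add: norm_mult algebra_simps)
      qed
      also have "\<dots> \<le> (C * \<kappa> ^ 8) * norm t ^ 4"
      proof (rule mult_mono)
        have "B + 64 * exp 10 \<le> C * 1" by (simp add: C_def)
        also have "\<dots> \<le> C * \<kappa> ^ 8" using k1 \<open>B > 0\<close>
          by (intro mult_left_mono) (auto simp: C_def intro!: add_nonneg_nonneg)
        finally show "B + 64 * exp 10 \<le> C * \<kappa> ^ 8" .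
        show "norm t ^ 5 \<le> norm t ^ 4" using True by (intro power_decreasing) auto
      qed (use \<open>B > 0\<close> k1 in \<open>auto simp: C_def intro!: add_nonneg_nonneg mult_nonneg_nonneg\<close>)
      finally show ?thesis .
    next
      case False
      have t4: "1 \<le> 16 * norm t ^ 4"
        using power_mono[of 1 "2 * norm t" 4] False by (simp add: power_mult_distrib)
      have i: "norm (1 / t) \<le> 2" using False by (simp add: norm_divide divide_le_eq)
      have "1 \<le> \<kappa> * (2 * Re t)" using \<kappa> False by linarith
      then have "1 / Re t \<le> 2 * \<kappa>" using t by (simp add: divide_le_eq mult_ac)
      then have h: "norm (1 / (exp t - 1)) \<le> 2 * \<kappa> ^ 8"
        using norm_inverse_exp_minus_1_le[OF t(1)] k1 by linarith
      have e: "norm (exp z) \<le> exp 10" if "norm z \<le> 10" for z :: complex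
        using that complex_Re_le_cmod[of z] by simp
      have s: "norm (exp t - exp (-t)) \<le> 2 * exp 10" "norm (exp (2 * t) - exp (- 2 * t)) \<le> 2 * exp 10"
      proof -
        have "norm (exp t) \<le> exp 10" "norm (exp (-t)) \<le> exp 10" "norm (exp (2 * t)) \<le> exp 10"
          "norm (exp (- 2 * t)) \<le> exp 10"
          by (rule e; use t in \<open>simp add: norm_mult\<close>)+
        then show "norm (exp t - exp (-t)) \<le> 2 * exp 10" "norm (exp (2 * t) - exp (- 2 * t)) \<le> 2 * exp 10"
          using norm_triangle_ineq4[of "exp t" "exp (-t)"] norm_triangle_ineq4[of "exp (2 * t)" "exp (- 2 * t)"]
          by linarith+
      qed
      have "norm (1 / t - (1 / 2 + 1 / (exp t - 1) - 41 / 720 * (exp t - exp (-t))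
                    + 11 / 1440 * (exp (2 * t) - exp (- 2 * t)))) \<le>
              norm (1 / t) + (1 / 2 + norm (1 / (exp t - 1)) + 41 / 720 * norm (exp t - exp (-t))
                    + 11 / 1440 * norm (exp (2 * t) - exp (- 2 * t)))"
        using norm_triangle_ineq4[of "1 / t" "1 / 2 + 1 / (exp t - 1) - 41 / 720 * (exp t - exp (-t))
                    + 11 / 1440 * (exp (2 * t) - exp (- 2 * t))"]
          norm_triangle_ineq[of "1 / 2 + 1 / (exp t - 1) - 41 / 720 * (exp t - exp (-t))"
            "11 / 1440 * (exp (2 * t) - exp (- 2 * t))"]
          norm_triangle_ineq4[of "1 / 2 + 1 / (exp t - 1)" "41 / 720 * (exp t - exp (-t))"]
          norm_triangle_ineq[of "1 / 2" "1 / (exp t - 1)"]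
          norm_mult[of "41 / 720" "exp t - exp (-t)"] norm_mult[of "11 / 1440" "exp (2 * t) - exp (- 2 * t)"]
        by (simp only: norm_divide norm_numeral norm_one)
      also have "\<dots> \<le> 2 + (1 / 2 + 2 * \<kappa> ^ 8 + 2 * exp 10 + 2 * exp 10)"
        using i h s norm_ge_zero[of "exp t - exp (-t)"] norm_ge_zero[of "exp (2 * t) - exp (- 2 * t)"]
        by (intro add_mono) argo+
      also have "\<dots> \<le> (5 + 4 * exp 10) * \<kappa> ^ 8"
      proof -
        have "(4 * exp 10) * 1 \<le> (4 * exp 10 :: real) * \<kappa> ^ 8"
          using k1 by (intro mult_left_mono) auto
        then show ?thesis using k1 unfolding distrib_right by linarith
      qed
      also have "\<dots> \<le> (5 + 4 * exp 10) * \<kappa> ^ 8 * (16 * norm t ^ 4)"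
        using mult_left_mono[OF t4, of "(5 + 4 * exp 10) * \<kappa> ^ 8"] k1 by simp
      also have "\<dots> = (16 * (5 + 4 * exp 10)) * (\<kappa> ^ 8 * norm t ^ 4)" by (simp only: mult_ac)
      also have "\<dots> \<le> C * (\<kappa> ^ 8 * norm t ^ 4)"
        using \<open>B > 0\<close> k1 by (intro mult_right_mono) (auto simp: C_def)
      finally show ?thesis by (simp add: mult_ac)
    qed
  qed
  moreover have "C > 0" using \<open>B > 0\<close> by (simp add: C_def add_pos_pos)
  ultimately show ?thesis using that[of C] by blast
qed

text \<open>The expansion \<open>pi^2 / (6 t^2) - 1 / (2 t) + 1 / 24\<close> with \<open>1 / t^2\<close> and \<open>1 / t\<close> replaced by
their approximations from the two preceding lemmas. In contrast to the expansion itself it is a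
Laurent series in \<open>exp (-t)\<close>, and its coefficients are explicit.\<close>
definition lambert_model :: "complex \<Rightarrow> complex" where
  "lambert_model t =
     of_real (pi\<^sup>2 / 6) * (lambert_term t + 1 / 12 - (exp t + exp (-t) - 2) / 240)
     - 1 / 2 * (1 / 2 + 1 / (exp t - 1) - 41 / 720 * (exp t - exp (-t))
                + 11 / 1440 * (exp (2 * t) - exp (- 2 * t)))
     + 1 / 24"

lemma lambert_series_model:
  obtains C where "C > 0"
    and "\<And>t \<kappa>. Re t > 0 \<Longrightarrow> \<kappa> \<ge> 1 \<Longrightarrow> norm t \<le> \<kappa> * Re t \<Longrightarrow> norm t \<le> 5 \<Longrightarrow>
           norm ((\<Sum>k. lambert_term (of_nat (Suc k) * t)) - lambert_model t) \<le> C * \<kappa> ^ 8 * norm t ^ 4"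
proof -
  obtain C1 where C1: "C1 > 0" "\<And>t \<kappa>. Re t > 0 \<Longrightarrow> \<kappa> \<ge> 1 \<Longrightarrow> norm t \<le> \<kappa> * Re t \<Longrightarrow> norm t \<le> 5 \<Longrightarrow>
      norm ((\<Sum>k. lambert_term (of_nat (Suc k) * t)) - (of_real (pi\<^sup>2 / 6) / t\<^sup>2 - 1 / (2 * t) + 1 / 24))
             \<le> C1 * \<kappa> ^ 8 * norm t ^ 4"
    using lambert_series_expansion by blast
  obtain C2 where C2: "C2 > 0" "\<And>t \<kappa>. Re t > 0 \<Longrightarrow> \<kappa> \<ge> 1 \<Longrightarrow> norm t \<le> \<kappa> * Re t \<Longrightarrow> norm t \<le> 5 \<Longrightarrow>
           norm (1 / t\<^sup>2 - (lambert_term t + 1 / 12 - (exp t + exp (-t) - 2) / 240)) \<le> C2 * \<kappa> ^ 8 * norm t ^ 4"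
    using inverse_square_approx by blast
  obtain C3 where C3: "C3 > 0" "\<And>t \<kappa>. Re t > 0 \<Longrightarrow> \<kappa> \<ge> 1 \<Longrightarrow> norm t \<le> \<kappa> * Re t \<Longrightarrow> norm t \<le> 5 \<Longrightarrow>
           norm (1 / t - (1 / 2 + 1 / (exp t - 1) - 41 / 720 * (exp t - exp (-t))
                    + 11 / 1440 * (exp (2 * t) - exp (- 2 * t)))) \<le> C3 * \<kappa> ^ 8 * norm t ^ 4"
    using inverse_approx by blast
  define z2 :: real where "z2 = pi\<^sup>2 / 6"
  have "z2 > 0" by (simp add: z2_def)
  have "norm ((\<Sum>k. lambert_term (of_nat (Suc k) * t)) - lambert_model t)
          \<le> (C1 + z2 * C2 + 1 / 2 * C3) * \<kappa> ^ 8 * norm t ^ 4"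
    if t: "Re t > 0" "\<kappa> \<ge> 1" "norm t \<le> \<kappa> * Re t" "norm t \<le> 5" for t \<kappa>
  proof -
    define a where "a = (\<Sum>k. lambert_term (of_nat (Suc k) * t)) - (of_real z2 / t\<^sup>2 - 1 / (2 * t) + 1 / 24)"
    define b where "b = 1 / t\<^sup>2 - (lambert_term t + 1 / 12 - (exp t + exp (-t) - 2) / 240)"
    define c where "c = 1 / t - (1 / 2 + 1 / (exp t - 1) - 41 / 720 * (exp t - exp (-t))
                    + 11 / 1440 * (exp (2 * t) - exp (- 2 * t)))"
    have "(\<Sum>k. lambert_term (of_nat (Suc k) * t)) - lambert_model t = a + of_real z2 * b - 1 / 2 * c"
      unfolding a_def b_def c_def lambert_model_def z2_def[symmetric] by (simp add: algebra_simps)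
    also have "norm \<dots> \<le> norm a + z2 * norm b + 1 / 2 * norm c"
      using norm_triangle_ineq4[of "a + of_real z2 * b" "1 / 2 * c"] norm_triangle_ineq[of a "of_real z2 * b"] \<open>z2 > 0\<close>
      by (simp add: norm_mult norm_divide)
    also have "\<dots> \<le> C1 * \<kappa> ^ 8 * norm t ^ 4 + z2 * (C2 * \<kappa> ^ 8 * norm t ^ 4) + 1 / 2 * (C3 * \<kappa> ^ 8 * norm t ^ 4)"
      using C1(2)[OF t] C2(2)[OF t] C3(2)[OF t] \<open>z2 > 0\<close>
      unfolding a_def b_def c_def z2_def by (intro add_mono mult_left_mono) auto
    also have "\<dots> = (C1 + z2 * C2 + 1 / 2 * C3) * \<kappa> ^ 8 * norm t ^ 4" by (simp add: algebra_simps)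
    finally show ?thesis .
  qed
  moreover have "C1 + z2 * C2 + 1 / 2 * C3 > 0" using C1 C2 C3 \<open>z2 > 0\<close> by (simp add: add_pos_pos)
  ultimately show ?thesis using that by blast
qed


section \<open>Coefficients as integrals over a circle\<close>

text \<open>For \<open>\<theta>\<close> from \<open>-pi\<close> to \<open>pi\<close> the points \<open>exp (- circ \<delta> \<theta>)\<close> run through the circle of radius
\<open>exp (-\<delta>)\<close> around 0.\<close>
definition circ :: "real \<Rightarrow> real \<Rightarrow> complex" where
  "circ \<delta> \<theta> = of_real \<delta> + \<i> * of_real \<theta>"

lemma Re_circ [simp]: "Re (circ \<delta> \<theta>) = \<delta>" and Im_circ [simp]: "Im (circ \<delta> \<theta>) = \<theta>"
  by (simp_all add: circ_def)

lemma continuous_on_circ [continuous_intros]: "continuous_on A (circ \<delta>)"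
  unfolding circ_def by (intro continuous_intros)

text \<open>The polynomial of \<open>kernel_fps M\<close> at \<open>u = exp (-t)\<close>, divided by \<open>u^(M + 1)\<close>. The division moves
the coefficient of interest to the constant term and makes the function even in \<open>t\<close>.\<close>
definition kern :: "nat \<Rightarrow> complex \<Rightarrow> complex" where
  "kern M t = (exp t + exp (-t) - 2) * (exp t + exp (-t) + 2) ^ M"

lemma continuous_on_kern [continuous_intros]: "continuous_on A (\<lambda>\<theta>. kern M (circ \<delta> \<theta>))"
  unfolding kern_def by (intro continuous_intros)

lemma kern_eq_sum:
  "kern M t = (\<Sum>i\<le>2 * Suc M. kernel_fps M $ i * exp (of_int (int (Suc M) - int i) * t))"
proof -
  define p :: "complex poly" where "p = [:1, -1:]\<^sup>2 * [:1, 1:] ^ (2 * M)"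
  have p1: "fps_of_poly [:1, -1:] = (1 - fps_X :: complex fps)"
    and p2: "fps_of_poly [:1, 1:] = (1 + fps_X :: complex fps)"
    by (simp_all add: fps_of_poly_pCons)
  have "fps_of_poly p = kernel_fps M"
    unfolding p_def kernel_fps_def fps_of_poly_mult fps_of_poly_power p1 p2 ..
  then have coeff: "coeff p i = kernel_fps M $ i" for i
    by (metis fps_of_poly_nth)
  have "degree p \<le> degree ([:1, -1 :: complex:]\<^sup>2) + degree ([:1, 1 :: complex:] ^ (2 * M))"
    unfolding p_def by (rule degree_mult_le)
  also have "\<dots> \<le> 1 * 2 + 1 * (2 * M)"
    by (intro add_mono order.trans[OF degree_power_le]) auto
  finally have deg: "degree p \<le> 2 * Suc M" by simp
  have e: "exp (-t) * exp t = 1" by (simp flip: exp_add)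
  have "kern M t = ((1 - exp (-t))\<^sup>2 * exp t) * ((1 + exp (-t))\<^sup>2 * exp t) ^ M"
  proof -
    have "(1 - exp (-t))\<^sup>2 * exp t = exp t - 2 * (exp (-t) * exp t) + exp (-t) * (exp (-t) * exp t)"
      by (simp add: power2_eq_square algebra_simps)
    then have 1: "(1 - exp (-t))\<^sup>2 * exp t = exp t + exp (-t) - 2" unfolding e by simp
    have "(1 + exp (-t))\<^sup>2 * exp t = exp t + 2 * (exp (-t) * exp t) + exp (-t) * (exp (-t) * exp t)"
      by (simp add: power2_eq_square algebra_simps)
    then have 2: "(1 + exp (-t))\<^sup>2 * exp t = exp t + exp (-t) + 2" unfolding e by simp
    show ?thesis unfolding 1 2 kern_def ..
  qed
  also have "\<dots> = poly p (exp (-t)) * exp t ^ Suc M"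
  proof -
    have "poly p (exp (-t)) = (1 - exp (-t))\<^sup>2 * ((1 + exp (-t))\<^sup>2) ^ M"
      by (simp add: p_def flip: power_mult)
    then show ?thesis by (simp only: power_mult_distrib power_Suc mult_ac)
  qed
  also have "poly p (exp (-t)) = (\<Sum>i\<le>2 * Suc M. kernel_fps M $ i * exp (-t) ^ i)"
    unfolding poly_altdef coeff
    by (intro sum.mono_neutral_left) (use deg in \<open>auto simp flip: coeff intro: coeff_eq_0\<close>)
  also have "(\<Sum>i\<le>2 * Suc M. kernel_fps M $ i * exp (-t) ^ i) * exp t ^ Suc M =
               (\<Sum>i\<le>2 * Suc M. kernel_fps M $ i * exp (of_int (int (Suc M) - int i) * t))"
    unfolding sum_distrib_right
  proof (intro sum.cong refl)
    fix i
    have "exp (-t) ^ i * exp t ^ Suc M = exp (of_int (int (Suc M) - int i) * t)"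
      unfolding exp_of_nat_mult[symmetric] exp_add[symmetric] by (simp add: algebra_simps)
    then show "kernel_fps M $ i * exp (-t) ^ i * exp t ^ Suc M =
                 kernel_fps M $ i * exp (of_int (int (Suc M) - int i) * t)"
      by (simp only: mult.assoc)
  qed
  finally show ?thesis .
qed

lemma kernel_fps_nth:
  "kernel_fps M $ Suc (Suc i) =
     of_nat ((2 * M) choose Suc (Suc i)) - 2 * of_nat ((2 * M) choose Suc i) + of_nat ((2 * M) choose i)"
proof -
  have "kernel_fps M = (1 + fps_X) ^ (2 * M) - fps_const 2 * (fps_X * (1 + fps_X) ^ (2 * M))
          + fps_X * (fps_X * (1 + fps_X) ^ (2 * M))"
    by (simp add: kernel_fps_def power2_eq_square algebra_simps numeral_fps_const)
  then show ?thesis by (simp add: one_plus_X_power_nth)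
qed

lemma kernel_fps_nth_eq_0:
  assumes "i > 2 * Suc M"
  shows "kernel_fps M $ i = 0"
proof -
  define j where "j = i - 2"
  have "i = Suc (Suc j)" using assms by (simp add: j_def)
  then show ?thesis using assms by (simp add: kernel_fps_nth binomial_eq_0)
qed

lemma has_integral_exp_circ:
  "((\<lambda>\<theta>. exp (of_int k * circ \<delta> \<theta>)) has_integral (if k = 0 then of_real (2 * pi) else 0)) {-pi..pi}"
proof (cases "k = 0")
  case True
  then show ?thesis
    using has_integral_const_real[of "1 :: complex" "-pi" pi] by (simp add: scaleR_conv_of_real)
next
  case False
  define g where "g z = exp (of_int k * (of_real \<delta> + \<i> * z)) / (of_int k * \<i>)" for z
  have "((\<lambda>\<theta>. exp (of_int k * circ \<delta> \<theta>)) has_integral (g (of_real pi) - g (of_real (-pi)))) {-pi..pi}"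
  proof (rule fundamental_theorem_of_calculus)
    fix x :: real
    have "(g has_field_derivative exp (of_int k * circ \<delta> x)) (at (of_real x))"
      unfolding g_def circ_def using False by (auto intro!: derivative_eq_intros)
    then show "((\<lambda>\<theta>. g (of_real \<theta>)) has_vector_derivative exp (of_int k * circ \<delta> x)) (at x within {-pi..pi})"
      by (rule has_vector_derivative_real_field)
  qed simp
  moreover have "exp (of_int k * (of_real \<delta> + \<i> * of_real pi)) = exp (of_int k * (of_real \<delta> + \<i> * of_real (-pi)))"
    unfolding exp_eq by (intro exI[of _ k]) (simp add: algebra_simps)
  ultimately show ?thesis using False by (simp add: g_def)
qed

text \<open>The mean of \<open>f\<close> times the kernel over the circle is \<open>v\<close>. If \<open>f t\<close> is a power series in \<open>exp (-t)\<close>,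
then \<open>v\<close> is the coefficient with index \<open>M + 1\<close> of its product with \<open>kernel_fps M\<close>. A relation
combines existence and value of the integral, so that linearity can be applied by resolution.\<close>
definition circle_coeff :: "nat \<Rightarrow> real \<Rightarrow> (complex \<Rightarrow> complex) \<Rightarrow> complex \<Rightarrow> bool" where
  "circle_coeff M \<delta> f v \<longleftrightarrow>
     ((\<lambda>\<theta>. f (circ \<delta> \<theta>) * kern M (circ \<delta> \<theta>)) has_integral (of_real (2 * pi) * v)) {-pi..pi}"

lemma circle_coeff_add:
  "circle_coeff M \<delta> f v \<Longrightarrow> circle_coeff M \<delta> g w \<Longrightarrow> circle_coeff M \<delta> (\<lambda>t. f t + g t) (v + w)"
  unfolding circle_coeff_def distrib_left distrib_right by (rule has_integral_add)

lemma circle_coeff_diff: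
  "circle_coeff M \<delta> f v \<Longrightarrow> circle_coeff M \<delta> g w \<Longrightarrow> circle_coeff M \<delta> (\<lambda>t. f t - g t) (v - w)"
  unfolding circle_coeff_def right_diff_distrib left_diff_distrib by (rule has_integral_diff)

lemma circle_coeff_cmult:
  assumes "circle_coeff M \<delta> f v"
  shows "circle_coeff M \<delta> (\<lambda>t. c * f t) (c * v)"
proof -
  have "((\<lambda>\<theta>. c * (f (circ \<delta> \<theta>) * kern M (circ \<delta> \<theta>))) has_integral c * (of_real (2 * pi) * v)) {-pi..pi}"
    using assms unfolding circle_coeff_def by (rule has_integral_mult_right)
  then show ?thesis unfolding circle_coeff_def by (simp only: mult_ac)
qed

lemma circle_coeff_cong:
  assumes "\<And>t. Re t = \<delta> \<Longrightarrow> f t = g t" "circle_coeff M \<delta> f v"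
  shows "circle_coeff M \<delta> g v"
  using assms unfolding circle_coeff_def by simp

text \<open>Integer indices make the orthogonality relation uniform in positive and negative exponents.\<close>
definition kernel_coeff :: "nat \<Rightarrow> int \<Rightarrow> complex" where
  "kernel_coeff M i = (if i < 0 then 0 else kernel_fps M $ nat i)"

lemma circle_coeff_exp:
  "circle_coeff M \<delta> (\<lambda>t. exp (of_int j * t)) (kernel_coeff M (int (Suc M) + j))"
proof -
  define m where "m = int (Suc M) + j"
  have "((\<lambda>\<theta>. \<Sum>i\<le>2 * Suc M. kernel_fps M $ i * exp (of_int (m - int i) * circ \<delta> \<theta>)) has_integral
          (\<Sum>i\<le>2 * Suc M. kernel_fps M $ i * (if m - int i = 0 then of_real (2 * pi) else 0))) {-pi..pi}"
    by (intro has_integral_sum has_integral_mult_right has_integral_exp_circ) auto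
  also have "(\<Sum>i\<le>2 * Suc M. kernel_fps M $ i * (if m - int i = 0 then of_real (2 * pi) else 0)) =
               of_real (2 * pi) * kernel_coeff M m"
  proof (cases "m < 0")
    case True
    then show ?thesis by (simp add: kernel_coeff_def)
  next
    case False
    then have "(\<Sum>i\<le>2 * Suc M. kernel_fps M $ i * (if m - int i = 0 then of_real (2 * pi) else 0)) =
                 (\<Sum>i\<le>2 * Suc M. if i = nat m then kernel_fps M $ i * of_real (2 * pi) else 0)"
      by (intro sum.cong) auto
    then show ?thesis using False kernel_fps_nth_eq_0[of M "nat m"]
      by (simp add: kernel_coeff_def sum.delta)
  qed
  also have "(\<lambda>\<theta>. \<Sum>i\<le>2 * Suc M. kernel_fps M $ i * exp (of_int (m - int i) * circ \<delta> \<theta>)) =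
               (\<lambda>\<theta>. exp (of_int j * circ \<delta> \<theta>) * kern M (circ \<delta> \<theta>))"
  proof
    fix \<theta>
    have "exp (of_int (m - int i) * circ \<delta> \<theta>) =
            exp (of_int j * circ \<delta> \<theta>) * exp (of_int (int (Suc M) - int i) * circ \<delta> \<theta>)" for i
      unfolding exp_add[symmetric] by (simp add: m_def algebra_simps)
    then show "(\<Sum>i\<le>2 * Suc M. kernel_fps M $ i * exp (of_int (m - int i) * circ \<delta> \<theta>)) =
                 exp (of_int j * circ \<delta> \<theta>) * kern M (circ \<delta> \<theta>)"
      unfolding kern_eq_sum sum_distrib_left by (intro sum.cong) (simp_all only: mult_ac)
  qed
  finally show ?thesis by (simp add: circle_coeff_def m_def)
qed

text \<open>The kernel is bounded on the circle, so the Weierstrass test makes the sum uniformly convergent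
and integration may be exchanged with summation.\<close>
lemma circle_coeff_suminf:
  assumes f: "\<And>k. circle_coeff M \<delta> (f k) (v k)"
    and cont: "\<And>k. continuous_on {-pi..pi} (\<lambda>\<theta>. f k (circ \<delta> \<theta>))"
    and B: "\<And>k t. Re t = \<delta> \<Longrightarrow> norm (f k t) \<le> B k" "summable B"
  shows "circle_coeff M \<delta> (\<lambda>t. \<Sum>k. f k t) (\<Sum>k. v k)"
proof -
  have "bounded ((\<lambda>\<theta>. kern M (circ \<delta> \<theta>)) ` {-pi..pi})"
    by (intro compact_imp_bounded compact_continuous_image continuous_intros) auto
  then obtain K where "\<forall>\<theta>\<in>{-pi..pi}. norm (kern M (circ \<delta> \<theta>)) \<le> K"
    by (auto simp: bounded_iff)
  then have K: "\<And>\<theta>. \<theta> \<in> {-pi..pi} \<Longrightarrow> norm (kern M (circ \<delta> \<theta>)) \<le> K" by blast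
  define g where "g k \<theta> = f k (circ \<delta> \<theta>) * kern M (circ \<delta> \<theta>)" for k \<theta>
  have ul: "uniform_limit {-pi..pi} (\<lambda>n \<theta>. \<Sum>k<n. g k \<theta>) (\<lambda>\<theta>. \<Sum>k. g k \<theta>) sequentially"
  proof (rule Weierstrass_m_test)
    show "norm (g k \<theta>) \<le> B k * K" if "\<theta> \<in> {-pi..pi}" for k \<theta>
      unfolding g_def norm_mult
      using B(1)[of "circ \<delta> \<theta>" k] K[OF that] by (intro mult_mono) (auto intro: order.trans[OF norm_ge_zero])
    show "summable (\<lambda>k. B k * K)" using B(2) by (rule summable_mult2)
  qed
  have "continuous_on {-pi..pi} (\<lambda>\<theta>. \<Sum>k<n. g k \<theta>)" for n
    unfolding g_def by (intro continuous_intros cont)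
  from uniform_limit_integral[OF ul this sequentially_bot] obtain I J where
    I: "\<And>n. ((\<lambda>\<theta>. \<Sum>k<n. g k \<theta>) has_integral I n) {-pi..pi}" and
    J: "((\<lambda>\<theta>. \<Sum>k. g k \<theta>) has_integral J) {-pi..pi}" and lim: "I \<longlonglongrightarrow> J" by blast
  have "((\<lambda>\<theta>. \<Sum>k<n. g k \<theta>) has_integral (\<Sum>k<n. of_real (2 * pi) * v k)) {-pi..pi}" for n
    using f unfolding g_def circle_coeff_def by (intro has_integral_sum) auto
  then have "I n = of_real (2 * pi) * (\<Sum>k<n. v k)" for n
    using I has_integral_unique unfolding sum_distrib_left by blast
  then have "(\<lambda>n. of_real (2 * pi) * (\<Sum>k<n. v k)) \<longlonglongrightarrow> J" using lim by presburger
  from tendsto_mult_left[OF this, of "inverse (of_real (2 * pi))"]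
  have "(\<lambda>n. \<Sum>k<n. v k) \<longlonglongrightarrow> inverse (of_real (2 * pi)) * J"
    by (simp add: mult.assoc[symmetric])
  then have "v sums (inverse (of_real (2 * pi)) * J)" by (simp add: sums_def)
  then have V: "of_real (2 * pi) * (\<Sum>k. v k) = J"
    by (simp add: sums_unique[symmetric])
  have "(\<Sum>k. g k \<theta>) = (\<Sum>k. f k (circ \<delta> \<theta>)) * kern M (circ \<delta> \<theta>)" for \<theta>
  proof -
    have "summable (\<lambda>k. f k (circ \<delta> \<theta>))"
      using B by (intro summable_comparison_test[OF _ B(2)]) auto
    then show ?thesis unfolding g_def by (rule suminf_mult2[symmetric])
  qed
  then show ?thesis using J V unfolding circle_coeff_def by simp
qed

text \<open>Cauchy's coefficient formula for a product, obtained from the orthogonality of exponentials.\<close>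
lemma circle_coeff_power_series:
  assumes F: "f has_fps_expansion F" and hol: "f holomorphic_on ball 0 1" and \<delta>: "\<delta> > 0"
  shows "circle_coeff M \<delta> (\<lambda>t. f (exp (-t))) ((kernel_fps M * F) $ Suc M)"
proof (rule circle_coeff_cong)
  have hol': "f holomorphic_on eball 0 1" using hol by (simp add: one_ereal_def)
  have rad: "fps_conv_radius F \<ge> 1"
    by (rule holomorphic_on_imp_fps_conv_radius_ge[OF F hol'])
  show "(\<Sum>N. F $ N * exp (-t) ^ N) = f (exp (-t))" if "Re t = \<delta>" for t
    using has_fps_expansion_imp_sums_complex[OF F hol', of "exp (-t)"] that \<delta>
    by (simp add: sums_iff one_ereal_def)
  have "circle_coeff M \<delta> (\<lambda>t. \<Sum>N. F $ N * exp (-t) ^ N)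
          (\<Sum>N. F $ N * kernel_coeff M (int (Suc M) + - int N))"
  proof (rule circle_coeff_suminf)
    fix N
    have "circle_coeff M \<delta> (\<lambda>t. F $ N * exp (of_int (- int N) * t))
            (F $ N * kernel_coeff M (int (Suc M) + - int N))"
      by (intro circle_coeff_cmult circle_coeff_exp)
    then show "circle_coeff M \<delta> (\<lambda>t. F $ N * exp (-t) ^ N) (F $ N * kernel_coeff M (int (Suc M) + - int N))"
    proof -
      have "exp (of_int (- int N) * t) = exp (-t) ^ N" for t :: complex
        unfolding exp_of_nat_mult[symmetric] by simp
      with \<open>circle_coeff M \<delta> (\<lambda>t. F $ N * exp (of_int (- int N) * t)) _\<close> show ?thesis by simp
    qed
    show "continuous_on {-pi..pi} (\<lambda>\<theta>. F $ N * exp (- circ \<delta> \<theta>) ^ N)" by (intro continuous_intros)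
    show "norm (F $ N * exp (-t) ^ N) \<le> norm (F $ N * of_real (exp (-\<delta>)) ^ N)" if "Re t = \<delta>" for t
      using that by (simp add: norm_mult norm_power)
  next
    show "summable (\<lambda>N. norm (F $ N * of_real (exp (-\<delta>)) ^ N))"
    proof (rule norm_summable_fps)
      have "ereal (norm (of_real (exp (-\<delta>)) :: complex)) < 1" using \<delta> by (simp add: one_ereal_def)
      then show "ereal (norm (of_real (exp (-\<delta>)) :: complex)) < fps_conv_radius F"
        using rad by (rule less_le_trans)
    qed
  qed
  also have "(\<Sum>N. F $ N * kernel_coeff M (int (Suc M) + - int N)) =
               (\<Sum>N\<le>Suc M. F $ N * kernel_coeff M (int (Suc M) + - int N))"
    by (rule suminf_finite) (auto simp: kernel_coeff_def)
  also have "\<dots> = (F * kernel_fps M) $ Suc M"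
    unfolding fps_mult_nth atLeast0AtMost
  proof (intro sum.cong refl)
    fix N assume "N \<in> {..Suc M}"
    then have "int (Suc M) + - int N = int (Suc M - N)" by auto
    then show "F $ N * kernel_coeff M (int (Suc M) + - int N) = F $ N * kernel_fps M $ (Suc M - N)"
      by (simp only: kernel_coeff_def of_nat_less_0_iff if_False nat_int)
  qed
  also have "F * kernel_fps M = kernel_fps M * F" by (rule mult.commute)
  finally show "circle_coeff M \<delta> (\<lambda>t. \<Sum>N. F $ N * exp (-t) ^ N) ((kernel_fps M * F) $ Suc M)" .
qed

lemma circle_coeff_lambert_term:
  assumes \<delta>: "\<delta> > 0" and k: "k > 0"
  shows "circle_coeff M \<delta> (\<lambda>t. lambert_term (of_nat k * t)) ((kernel_fps M * lambert_fps k) $ Suc M)"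
proof (rule circle_coeff_cong)
  define f :: "complex \<Rightarrow> complex" where "f u = u ^ k * inverse ((1 - u ^ k)\<^sup>2)" for u
  have "((1 - fps_X ^ k :: complex fps)\<^sup>2) $ 0 \<noteq> 0"
    using k by (simp add: fps_power_zeroth power_0_left)
  then have F: "f has_fps_expansion lambert_fps k"
    unfolding f_def lambert_fps_def by (intro fps_expansion_intros)
  have nz: "u ^ k \<noteq> 1" if "norm u < 1" for u :: complex
  proof
    assume "u ^ k = 1"
    then have "norm u ^ k = 1" by (metis norm_one norm_power)
    then show False using that k power_less_one_iff[of "norm u" k] by simp
  qed
  have "f holomorphic_on ball 0 1"
    unfolding f_def by (intro holomorphic_intros) (use nz in auto)
  from circle_coeff_power_series[OF F this \<delta>]
  show "circle_coeff M \<delta> (\<lambda>t. f (exp (-t))) ((kernel_fps M * lambert_fps k) $ Suc M)" .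
  fix t assume t: "Re t = \<delta>"
  define e where "e = exp (of_nat k * t)"
  have "e \<noteq> 0" by (simp add: e_def)
  have "e \<noteq> 1" unfolding e_def by (rule exp_neq_1_if_Re_pos) (use t \<delta> k in simp)
  have "exp (-t) ^ k = inverse e"
    by (simp only: e_def exp_of_nat_mult[symmetric] mult_minus_right) (rule exp_minus)
  moreover have "lambert_term (of_nat k * t) = 1 / (e + inverse e - 2)"
    by (simp add: lambert_term_def e_def exp_minus)
  moreover have "inverse e * inverse ((1 - inverse e)\<^sup>2) = 1 / (e + inverse e - 2)"
  proof -
    have "(1 - inverse e)\<^sup>2 * e = e + inverse e - 2"
      using \<open>e \<noteq> 0\<close> by (simp add: power2_eq_square field_simps)
    then show ?thesis by (metis inverse_eq_divide inverse_mult_distrib mult.commute)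
  qed
  ultimately show "f (exp (-t)) = lambert_term (of_nat k * t)" by (simp add: f_def)
qed

section \<open>Central coefficients of the kernel\<close>

text \<open>The kernel coefficients are second differences of a row of Pascal's triangle. Around the centre of
the row they are rational multiples of the central entry.\<close>
lemma central_kernel_coeffs:
  fixes m :: nat
  defines "M \<equiv> m + 3" and "n \<equiv> m + 4"
  defines "\<beta> \<equiv> (of_nat ((2 * M) choose M) :: complex)"
  shows "kernel_fps M $ (n + 1) = kernel_fps M $ (n - 1)"
    and "kernel_fps M $ (n + 2) = kernel_fps M $ (n - 2)"
    and "kernel_fps M $ n = - 2 * \<beta> / of_nat n"
    and "2 * kernel_fps M $ (n - 1) - 2 * kernel_fps M $ n = 12 * \<beta> / (of_nat n * of_nat (n + 1))"
proof -
  define b where "b i = (of_nat ((2 * M) choose i) :: complex)" for i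
  have k: "kernel_fps M $ Suc (Suc i) = b (Suc (Suc i)) - 2 * b (Suc i) + b i" for i
    by (simp add: kernel_fps_nth b_def)
  have sym: "b (m + 4) = b (m + 2)" "b (m + 5) = b (m + 1)" "b (m + 6) = b m"
    using binomial_symmetric[of "m + 4" "2 * M"] binomial_symmetric[of "m + 5" "2 * M"]
      binomial_symmetric[of "m + 6" "2 * M"]
    by (simp_all add: b_def M_def)
  have k': "kernel_fps M $ (n - 2) = b (m + 2) - 2 * b (m + 1) + b m"
    "kernel_fps M $ (n - 1) = b (m + 3) - 2 * b (m + 2) + b (m + 1)"
    "kernel_fps M $ n = b (m + 4) - 2 * b (m + 3) + b (m + 2)"
    "kernel_fps M $ (n + 1) = b (m + 5) - 2 * b (m + 4) + b (m + 3)"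
    "kernel_fps M $ (n + 2) = b (m + 6) - 2 * b (m + 5) + b (m + 4)"
    using k[of m] k[of "m + 1"] k[of "m + 2"] k[of "m + 3"] k[of "m + 4"]
    by (simp_all add: n_def eval_nat_numeral)
  show "kernel_fps M $ (n + 1) = kernel_fps M $ (n - 1)"
    "kernel_fps M $ (n + 2) = kernel_fps M $ (n - 2)"
    unfolding k' by (simp_all add: sym)
  have \<beta>: "\<beta> = b (m + 3)" by (simp add: \<beta>_def b_def M_def)
  have r1: "of_nat n * b (m + 2) = of_nat (m + 3) * \<beta>"
  proof -
    have "Suc (m + 3) * ((2 * M) choose Suc (m + 3)) = (2 * M - (m + 3)) * ((2 * M) choose (m + 3))"
      by (rule Suc_times_choose_Suc)
    then have "of_nat (Suc (m + 3)) * b (Suc (m + 3)) = of_nat (2 * M - (m + 3)) * b (m + 3)"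
      unfolding b_def of_nat_mult[symmetric] by simp
    moreover have "Suc (m + 3) = n" "2 * M - (m + 3) = m + 3" by (simp_all add: n_def M_def)
    moreover have "b n = b (m + 2)" using sym by (simp add: n_def)
    ultimately show ?thesis unfolding \<beta> by metis
  qed
  have r2: "of_nat (n + 1) * b (m + 1) = of_nat (m + 2) * b (m + 2)"
  proof -
    have "Suc (m + 4) * ((2 * M) choose Suc (m + 4)) = (2 * M - (m + 4)) * ((2 * M) choose (m + 4))"
      by (rule Suc_times_choose_Suc)
    then have "of_nat (Suc (m + 4)) * b (Suc (m + 4)) = of_nat (2 * M - (m + 4)) * b (m + 4)"
      unfolding b_def of_nat_mult[symmetric] by simp
    moreover have "Suc (m + 4) = n + 1" "2 * M - (m + 4) = m + 2" by (simp_all add: n_def M_def)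
    moreover have "b (n + 1) = b (m + 1)" using sym by (simp add: n_def eval_nat_numeral)
    ultimately show ?thesis unfolding sym by metis
  qed
  have n0: "of_nat n \<noteq> (0 :: complex)" "of_nat (n + 1) \<noteq> (0 :: complex)"
    unfolding of_nat_eq_0_iff by (simp_all add: n_def)
  define N :: complex where "N = of_nat n"
  have N: "of_nat (m + 3) = N - 1" "of_nat (m + 2) = N - 2" "of_nat (n + 1) = N + 1"
    by (simp_all add: N_def n_def)
  have N0: "N \<noteq> 0" "N + 1 \<noteq> 0" using n0(1)[folded N_def] n0(2)[unfolded N(3)] by auto
  have "N * b (m + 2) = (N - 1) * \<beta>" using r1 unfolding N N_def[symmetric] .
  then have b2: "b (m + 2) = (N - 1) * \<beta> / N" using N0 by (simp add: nonzero_eq_divide_eq mult_ac)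
  have "(N + 1) * b (m + 1) = (N - 2) * b (m + 2)" using r2 unfolding N .
  then have b1: "b (m + 1) = (N - 2) * ((N - 1) * \<beta> / N) / (N + 1)"
    unfolding b2 using N0 by (simp add: nonzero_eq_divide_eq mult_ac)
  show "kernel_fps M $ n = - 2 * \<beta> / of_nat n"
    unfolding k' sym b2 \<beta>[symmetric] N_def[symmetric] using N0 by (simp add: field_simps)
  show "2 * kernel_fps M $ (n - 1) - 2 * kernel_fps M $ n = 12 * \<beta> / (of_nat n * of_nat (n + 1))"
    unfolding k' sym b2 b1 \<beta>[symmetric] N N_def[symmetric] using N0 by (simp add: divide_simps) (simp add: algebra_simps)
qed

section \<open>Size of the kernel\<close>

text \<open>By doubling the angle, from \<open>sin y \<ge> y cos y\<close> and \<open>cos y \<ge> cos (pi / 4)\<close> at \<open>y = x / 2\<close>.\<close>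
lemma half_le_sin:
  fixes x :: real
  assumes "0 \<le> x" "x \<le> pi / 2"
  shows "x / 2 \<le> sin x"
proof -
  have y: "y * cos y \<le> sin y" if "0 \<le> y" "y \<le> pi / 4" for y :: real
  proof -
    define g where "g y = sin y - y * cos y" for y :: real
    have "g 0 \<le> g y"
    proof (rule DERIV_nonneg_imp_nondecreasing[OF that(1)])
      fix z :: real assume z: "0 \<le> z" "z \<le> y"
      have "(g has_real_derivative z * sin z) (at z)"
        unfolding g_def by (auto intro!: derivative_eq_intros)
      moreover have "z * sin z \<ge> 0"
        using z that pi_gt_zero by (intro mult_nonneg_nonneg sin_ge_zero) auto
      ultimately show "\<exists>d. (g has_real_derivative d) (at z) \<and> d \<ge> 0" by blast
    qed
    then show ?thesis by (simp add: g_def)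
  qed
  define y where "y = x / 2"
  have y0: "0 \<le> y" "y \<le> pi / 4" using assms by (auto simp: y_def)
  have "cos (pi / 4) \<le> cos y" using y0 by (intro cos_monotone_0_pi_le) auto
  then have "(cos (pi / 4))\<^sup>2 \<le> (cos y)\<^sup>2" by (intro power_mono) (auto simp: cos_45)
  then have c: "1 / 2 \<le> (cos y)\<^sup>2" by (simp add: cos_45 power_divide)
  have "x / 2 = 2 * y * (1 / 2)" by (simp add: y_def)
  also have "\<dots> \<le> 2 * y * (cos y)\<^sup>2" using c y0 by (intro mult_left_mono) auto
  also have "\<dots> = 2 * (y * cos y) * cos y" by (simp add: power2_eq_square)
  also have "\<dots> \<le> 2 * sin y * cos y"
    using y[OF y0] y0 pi_gt_zero by (intro mult_right_mono mult_left_mono cos_ge_zero) auto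
  also have "\<dots> = sin x" using sin_double[of y] by (simp add: y_def)
  finally show ?thesis .
qed

lemma cos_le_quadratic:
  fixes \<theta> :: real
  assumes "\<bar>\<theta>\<bar> \<le> pi"
  shows "cos \<theta> \<le> 1 - \<theta>\<^sup>2 / 8"
proof -
  have "\<bar>\<theta>\<bar> / 2 / 2 \<le> sin (\<bar>\<theta>\<bar> / 2)" using assms by (intro half_le_sin) auto
  then have "(\<bar>\<theta>\<bar> / 2 / 2)\<^sup>2 \<le> (sin (\<bar>\<theta>\<bar> / 2))\<^sup>2" by (intro power_mono) auto
  then have "\<theta>\<^sup>2 / 16 \<le> (sin (\<bar>\<theta>\<bar> / 2))\<^sup>2" by (simp add: power_divide)
  moreover have "cos \<bar>\<theta>\<bar> = 1 - 2 * (sin (\<bar>\<theta>\<bar> / 2))\<^sup>2"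
    using cos_double_sin[of "\<bar>\<theta>\<bar> / 2"] by simp
  ultimately show ?thesis by simp
qed

lemma norm_exp_sum_plus_2:
  "norm (exp t + exp (-t) + 2) = exp (Re t) + exp (- Re t) + 2 * cos (Im t)"
proof -
  have "exp t + exp (-t) + 2 = exp t * (1 + exp (-t))\<^sup>2"
    by (simp add: power2_eq_square algebra_simps exp_minus field_simps)
  moreover have "(norm (1 + exp (-t)))\<^sup>2 = 1 + 2 * exp (- Re t) * cos (Im t) + (exp (- Re t))\<^sup>2"
  proof -
    have "(norm (1 + exp (-t)))\<^sup>2 = (1 + exp (- Re t) * cos (Im t))\<^sup>2 + (exp (- Re t) * sin (Im t))\<^sup>2"
      by (simp add: cmod_power2 Re_exp Im_exp)
    also have "(1 + e * c)\<^sup>2 + (e * s)\<^sup>2 = 1 + 2 * e * c + e\<^sup>2 * (s\<^sup>2 + c\<^sup>2)" for e c s :: real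
      by (simp add: power2_eq_square algebra_simps)
    finally show ?thesis by simp
  qed
  ultimately have "norm (exp t + exp (-t) + 2) =
      exp (Re t) * (1 + 2 * exp (- Re t) * cos (Im t) + (exp (- Re t))\<^sup>2)"
    by (simp add: norm_mult norm_power)
  also have "\<dots> = exp (Re t) + exp (- Re t) + 2 * cos (Im t)"
    by (simp add: power2_eq_square algebra_simps exp_minus)
  finally show ?thesis .
qed

lemma exp_sum_le:
  fixes d :: real
  assumes "0 \<le> d" "d \<le> 1"
  shows "exp d + exp (- d) \<le> 2 + 2 * d\<^sup>2"
proof -
  have 1: "exp d \<le> 1 + d + d\<^sup>2" using assms by (rule exp_bound)
  have "(1 + d) * exp (-d) \<le> exp d * exp (-d)"
    by (intro mult_right_mono exp_ge_add_one_self) auto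
  also have "\<dots> = 1" by (simp flip: exp_add)
  also have "1 \<le> (1 + d) * (1 - d + d\<^sup>2)"
  proof -
    have "(1 + d) * (1 - d + d\<^sup>2) = 1 + d ^ 3" by (simp add: algebra_simps eval_nat_numeral)
    then show ?thesis using assms by simp
  qed
  finally have "exp (-d) \<le> 1 - d + d\<^sup>2" using assms by (simp add: mult_le_cancel_left_pos)
  then show ?thesis using 1 by simp
qed

text \<open>The first factor of the kernel has a double zero at 0. The second one has absolute value
\<open>2 (cosh \<delta> + cos \<theta>)\<close> to the power \<open>M\<close>; with \<open>\<delta> = 1 / sqrt n\<close> the hyperbolic cosine costs only a
constant factor, and the cosine yields the Gaussian decay.\<close>
lemma norm_kern_le:
  assumes M: "M \<ge> 1" and \<theta>: "\<bar>\<theta>\<bar> \<le> pi"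
  defines "\<delta> \<equiv> 1 / sqrt (real (Suc M))"
  shows "norm (kern M (circ \<delta> \<theta>)) \<le>
           4 * exp 5 * (norm (circ \<delta> \<theta>))\<^sup>2 * 4 ^ M * exp (- (real (Suc M) * \<theta>\<^sup>2) / 32)"
proof -
  define n where "n = real (Suc M)"
  define t where "t = circ \<delta> \<theta>"
  have n: "n \<ge> 2" "n = real M + 1" using M by (auto simp: n_def)
  have \<delta>: "0 < \<delta>" "\<delta> \<le> 1" "\<delta>\<^sup>2 = 1 / n"
    using n by (auto simp: \<delta>_def n_def power_divide)
  have nt: "norm t \<le> 5"
  proof -
    have "norm t \<le> \<bar>Re t\<bar> + \<bar>Im t\<bar>" by (rule cmod_le)
    then show ?thesis using \<delta> \<theta> pi_less_4 by (simp add: t_def)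
  qed
  \<comment> \<open>the linear terms of the two exponentials cancel\<close>
  define E where "E z = exp z - (\<Sum>i\<le>1. z ^ i / fact i)" for z :: complex
  have E: "norm (E z) \<le> exp 5 * (norm t)\<^sup>2" if "norm z = norm t" for z
  proof -
    have "norm (E z) \<le> exp (norm z) * norm z ^ Suc 1 / fact 1"
      unfolding E_def by (rule Taylor_exp_field)
    also have "\<dots> \<le> exp 5 * (norm t)\<^sup>2"
      using nt that by (simp add: mult_right_mono power2_eq_square)
    finally show ?thesis .
  qed
  have "exp t + exp (-t) - 2 = E t + E (-t)" by (simp add: E_def)
  then have 1: "norm (exp t + exp (-t) - 2) \<le> 2 * exp 5 * (norm t)\<^sup>2"
    using norm_triangle_ineq[of "E t" "E (-t)"] E[of t] E[of "-t"] by simp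
  have "norm (exp t + exp (-t) + 2) \<le> (2 + 2 * \<delta>\<^sup>2) + 2 * (1 - \<theta>\<^sup>2 / 8)"
    unfolding norm_exp_sum_plus_2 using exp_sum_le[of \<delta>] cos_le_quadratic[OF \<theta>] \<delta>
    by (simp add: t_def)
  also have "\<dots> = 4 * (1 + (\<delta>\<^sup>2 / 2 - \<theta>\<^sup>2 / 16))" by (simp add: field_simps)
  also have "\<dots> \<le> 4 * exp (\<delta>\<^sup>2 / 2 - \<theta>\<^sup>2 / 16)"
    by (intro mult_left_mono exp_ge_add_one_self) auto
  finally have "norm (exp t + exp (-t) + 2) ^ M \<le> (4 * exp (\<delta>\<^sup>2 / 2 - \<theta>\<^sup>2 / 16)) ^ M"
    by (intro power_mono) auto
  also have "\<dots> = 4 ^ M * exp (real M * (\<delta>\<^sup>2 / 2 - \<theta>\<^sup>2 / 16))"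
    by (simp add: power_mult_distrib exp_of_nat_mult)
  also have "\<dots> \<le> 4 ^ M * (2 * exp (- (n * \<theta>\<^sup>2) / 32))"
  proof (rule mult_left_mono)
    have "real M * \<delta>\<^sup>2 \<le> 1" using \<delta> n by (simp add: divide_le_eq)
    moreover have "n * \<theta>\<^sup>2 \<le> (2 * real M) * \<theta>\<^sup>2" using n M by (intro mult_right_mono) auto
    ultimately have "real M * (\<delta>\<^sup>2 / 2 - \<theta>\<^sup>2 / 16) \<le> 1 / 2 + - (n * \<theta>\<^sup>2) / 32"
      by (simp add: algebra_simps)
    then have "exp (real M * (\<delta>\<^sup>2 / 2 - \<theta>\<^sup>2 / 16)) \<le> exp (1 / 2) * exp (- (n * \<theta>\<^sup>2) / 32)"
      by (simp flip: exp_add)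
    also have "\<dots> \<le> 2 * exp (- (n * \<theta>\<^sup>2) / 32)" using exp_half_le2 by (intro mult_right_mono) auto
    finally show "exp (real M * (\<delta>\<^sup>2 / 2 - \<theta>\<^sup>2 / 16)) \<le> 2 * exp (- (n * \<theta>\<^sup>2) / 32)" .
  qed auto
  finally have 2: "norm (exp t + exp (-t) + 2) ^ M \<le> 4 ^ M * (2 * exp (- (n * \<theta>\<^sup>2) / 32))" .
  have "norm (kern M t) \<le> (2 * exp 5 * (norm t)\<^sup>2) * (4 ^ M * (2 * exp (- (n * \<theta>\<^sup>2) / 32)))"
    unfolding kern_def norm_mult norm_power by (intro mult_mono 1 2) auto
  then show ?thesis by (simp add: t_def n_def mult_ac)
qed

lemma power_7_times_exp_le:
  fixes y :: real
  assumes "y \<ge> 0"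
  shows "(1 + y) ^ 7 * exp (- y / 32) \<le> 32 ^ 8 * fact 8 * exp 1 / (1 + y)"
proof -
  \<comment> \<open>a single term of the exponential series bounds the power; 32 is the width of the Gaussian\<close>
  define x where "x = (1 + y) / 32"
  have x: "x \<ge> 0" "1 + y = 32 * x" using assms by (auto simp: x_def)
  have "x ^ 8 / fact 8 \<le> exp x"
  proof -
    have s: "(\<lambda>n. x ^ n / fact n) sums exp x"
      using exp_converges[of x] by (simp add: divide_inverse mult.commute)
    have "(\<Sum>n\<in>{8}. x ^ n / fact n) \<le> (\<Sum>n. x ^ n / fact n)"
      using x s by (intro sum_le_suminf sums_summable[OF s]) auto
    then show ?thesis using sums_unique[OF s] by simp
  qed
  then have "x ^ 8 \<le> fact 8 * exp x" by (simp add: divide_le_eq mult.commute)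
  then have "(1 + y) ^ 8 * exp (- y / 32) \<le> 32 ^ 8 * (fact 8 * exp x) * exp (- y / 32)"
    unfolding x(2) power_mult_distrib by (intro mult_right_mono mult_left_mono) auto
  also have "\<dots> = 32 ^ 8 * fact 8 * exp (1 / 32)"
    by (simp add: mult.assoc x_def flip: exp_add) (simp add: field_simps)
  also have "\<dots> \<le> 32 ^ 8 * fact 8 * exp 1" by (intro mult_left_mono) auto
  finally have "(1 + y) ^ 7 * exp (- y / 32) * (1 + y) \<le> 32 ^ 8 * fact 8 * exp 1"
    by (simp add: eval_nat_numeral mult_ac)
  then show ?thesis using assms by (simp add: pos_le_divide_eq)
qed

lemma integral_inverse_quadratic:
  fixes n :: real
  assumes "n > 0"
  shows "((\<lambda>\<theta>. 1 / (1 + n * \<theta>\<^sup>2)) has_integral (2 * arctan (sqrt n * pi) / sqrt n)) {-pi..pi}"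
proof -
  define g where "g \<theta> = arctan (sqrt n * \<theta>) / sqrt n" for \<theta>
  have "((\<lambda>\<theta>. 1 / (1 + n * \<theta>\<^sup>2)) has_integral (g pi - g (-pi))) {-pi..pi}"
  proof (rule fundamental_theorem_of_calculus)
    fix x :: real
    have "1 + n * x\<^sup>2 \<noteq> 0" using assms by (smt (verit) mult_nonneg_nonneg zero_le_power2)
    have "(g has_real_derivative 1 / (1 + n * x\<^sup>2)) (at x)"
      unfolding g_def using assms
      by (auto intro!: derivative_eq_intros simp: power_mult_distrib mult.assoc inverse_eq_divide)
    then show "(g has_vector_derivative 1 / (1 + n * x\<^sup>2)) (at x within {-pi..pi})"
      by (simp add: has_real_derivative_iff_has_vector_derivative has_vector_derivative_at_within)
  qed auto
  then show ?thesis by (simp add: g_def arctan_minus)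
qed

text \<open>With \<open>\<kappa> = |t| / \<delta>\<close> one has \<open>\<kappa>^2 = 1 + n \<theta>^2\<close> on the circle, and the integrand is at most a
constant times \<open>4^M n^(-3) \<kappa>^14 exp (- n \<theta>^2 / 32)\<close>. The Gaussian reduces the power of \<open>\<kappa>\<close> to
\<open>\<kappa>^(-2)\<close>, whose integral is of the order \<open>1 / sqrt n\<close>.\<close>
lemma circle_coeff_bound:
  assumes M: "M \<ge> 1" and C: "C \<ge> 0"
  defines "\<delta> \<equiv> 1 / sqrt (real (Suc M))"
  assumes coeff: "circle_coeff M \<delta> f v"
    and bound: "\<And>\<theta>. \<bar>\<theta>\<bar> \<le> pi \<Longrightarrow>
      norm (f (circ \<delta> \<theta>)) \<le> C * (norm (circ \<delta> \<theta>) / \<delta>) ^ 8 * norm (circ \<delta> \<theta>) ^ 4"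
  shows "norm v \<le> C * (4 * exp 5 * (32 ^ 8 * fact 8 * exp 1)) * 4 ^ M / (real (Suc M) ^ 3 * sqrt (real (Suc M)))"
proof -
  define n where "n = real (Suc M)"
  have n: "n > 0" by (simp add: n_def)
  \<comment> \<open>the constant of the bound that absorbs the powers of \<open>\<kappa>\<close>\<close>
  define D :: real where "D = 32 ^ 8 * fact 8 * exp 1"
  have "D > 0" by (simp add: D_def)
  have \<delta>: "\<delta> > 0" "\<delta>\<^sup>2 = 1 / n" using n by (auto simp: \<delta>_def n_def power_divide)
  define A where "A = C * (4 * exp 5 * D) * 4 ^ M / n ^ 3"
  have "A \<ge> 0" using C n \<open>D > 0\<close> by (simp add: A_def)
  have pt: "norm (f (circ \<delta> \<theta>) * kern M (circ \<delta> \<theta>)) \<le> A * (1 / (1 + n * \<theta>\<^sup>2))" if "\<theta> \<in> {-pi..pi}" for \<theta>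
  proof -
    have \<theta>: "\<bar>\<theta>\<bar> \<le> pi" using that by auto
    define \<kappa> where "\<kappa> = norm (circ \<delta> \<theta>) / \<delta>"
    have t: "norm (circ \<delta> \<theta>) = \<kappa> * \<delta>" using \<delta> by (simp add: \<kappa>_def)
    have "\<kappa>\<^sup>2 = (\<delta>\<^sup>2 + \<theta>\<^sup>2) / \<delta>\<^sup>2" by (simp add: \<kappa>_def power_divide cmod_power2)
    also have "\<dots> = 1 + n * \<theta>\<^sup>2" unfolding \<delta>(2) using n by (simp add: field_simps)
    finally have \<kappa>: "\<kappa>\<^sup>2 = 1 + n * \<theta>\<^sup>2" .
    have "norm (f (circ \<delta> \<theta>) * kern M (circ \<delta> \<theta>)) \<le>
            (C * \<kappa> ^ 8 * (\<kappa> * \<delta>) ^ 4) * (4 * exp 5 * (\<kappa> * \<delta>)\<^sup>2 * 4 ^ M * exp (- (n * \<theta>\<^sup>2) / 32))"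
      unfolding norm_mult
    proof (rule mult_mono)
      show "norm (f (circ \<delta> \<theta>)) \<le> C * \<kappa> ^ 8 * (\<kappa> * \<delta>) ^ 4"
        using bound[OF \<theta>] unfolding \<kappa>_def[symmetric] unfolding t .
      show "norm (kern M (circ \<delta> \<theta>)) \<le> 4 * exp 5 * (\<kappa> * \<delta>)\<^sup>2 * 4 ^ M * exp (- (n * \<theta>\<^sup>2) / 32)"
        using norm_kern_le[OF M \<theta>] unfolding \<delta>_def[symmetric] t n_def .
      show "C * \<kappa> ^ 8 * (\<kappa> * \<delta>) ^ 4 \<ge> 0" using C by simp
    qed simp
    also have "\<dots> = (C * (4 * exp 5) * 4 ^ M * (\<delta>\<^sup>2) ^ 3) * ((\<kappa>\<^sup>2) ^ 7 * exp (- (n * \<theta>\<^sup>2) / 32))"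
      by (simp add: eval_nat_numeral power_mult_distrib mult_ac)
    also have "\<dots> \<le> (C * (4 * exp 5) * 4 ^ M * (\<delta>\<^sup>2) ^ 3) * (D / (1 + n * \<theta>\<^sup>2))"
      unfolding \<kappa> D_def using C n by (intro mult_left_mono power_7_times_exp_le) auto
    also have "\<dots> = A * (1 / (1 + n * \<theta>\<^sup>2))"
      unfolding \<delta>(2) by (simp add: A_def power_divide field_simps)
    finally show ?thesis .
  qed
  have I: "((\<lambda>\<theta>. f (circ \<delta> \<theta>) * kern M (circ \<delta> \<theta>)) has_integral (of_real (2 * pi) * v)) {-pi..pi}"
    using coeff by (simp add: circle_coeff_def)
  have J: "((\<lambda>\<theta>. A * (1 / (1 + n * \<theta>\<^sup>2))) has_integral (A * (2 * arctan (sqrt n * pi) / sqrt n))) {-pi..pi}"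
    by (intro has_integral_mult_right integral_inverse_quadratic n)
  have "norm (of_real (2 * pi) * v) \<le> A * (2 * arctan (sqrt n * pi) / sqrt n)"
    using integral_norm_bound_integral[OF has_integral_integrable[OF I] has_integral_integrable[OF J] pt]
    by (simp only: integral_unique[OF I] integral_unique[OF J])
  also have "\<dots> \<le> A * (2 * pi / sqrt n)"
  proof (intro mult_left_mono divide_right_mono)
    show "arctan (sqrt n * pi) \<le> pi" using arctan_ubound[of "sqrt n * pi"] pi_gt_zero by linarith
  qed (use \<open>A \<ge> 0\<close> n in auto)
  also have "\<dots> = 2 * pi * (A / sqrt n)" by simp
  finally have "2 * pi * norm v \<le> 2 * pi * (A / sqrt n)" by (simp add: norm_mult)
  then have "norm v \<le> A / sqrt n" by (rule mult_left_le_imp_le) simp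
  also have "A / sqrt n = C * (4 * exp 5 * D) * 4 ^ M / (n ^ 3 * sqrt n)" by (simp add: A_def)
  finally show ?thesis by (simp add: D_def n_def)
qed

text \<open>The sharp order of the central binomial coefficient: the factor \<open>1 / sqrt n\<close> from the integral
has to be compensated completely.\<close>
lemma central_binomial_ge:
  assumes "M \<ge> 1"
  shows "4 ^ M \<le> 2 * sqrt (real M) * real ((2 * M) choose M)"
  using assms
proof (induction M rule: dec_induct)
  case (step M)
  define B where "B = real ((2 * M) choose M)"
  define B' where "B' = real ((2 * Suc M) choose Suc M)"
  have M: "M \<ge> 1" using step by simp
  have B': "B' * (real M + 1) = 2 * (2 * real M + 1) * B"
  proof -
    have 1: "Suc M * ((2 * Suc M) choose Suc M) = (2 * Suc M) * ((2 * M + 1) choose M)"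
      using Suc_times_binomial[of M "2 * M + 1"] by simp
    have 2: "(2 * M + 1) choose M = (2 * M + 1) choose (Suc M)"
      using binomial_symmetric[of M "2 * M + 1"] by simp
    have 3: "Suc M * ((2 * M + 1) choose Suc M) = (2 * M + 1) * ((2 * M) choose M)"
      using Suc_times_binomial[of M "2 * M"] by simp
    have "Suc M * ((2 * Suc M) choose Suc M) = 2 * ((2 * M + 1) * ((2 * M) choose M))"
      unfolding 1 2 mult.assoc 3 ..
    then have "real (Suc M * ((2 * Suc M) choose Suc M)) = real (2 * ((2 * M + 1) * ((2 * M) choose M)))"
      by (rule arg_cong)
    then have "real (Suc M) * B' = 2 * (real (2 * M + 1) * B)"
      unfolding B_def B'_def of_nat_mult of_nat_numeral .
    then show ?thesis by (simp add: algebra_simps)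
  qed
  have sq: "sqrt (real M) * (real M + 1) * 4 \<le> 2 * (2 * real M + 1) * sqrt (real M + 1)"
  proof (rule power2_le_imp_le)
    have "(sqrt (real M) * (real M + 1) * 4)\<^sup>2 = (4 * (real M + 1)) * (4 * real M * (real M + 1))"
      by (simp add: power_mult_distrib) (simp add: power2_eq_square algebra_simps)
    also have "\<dots> \<le> (4 * (real M + 1)) * (2 * real M + 1)\<^sup>2"
      by (intro mult_left_mono) (auto simp: power2_eq_square algebra_simps)
    also have "\<dots> = (2 * (2 * real M + 1) * sqrt (real M + 1))\<^sup>2"
      by (simp add: power_mult_distrib) (simp add: power2_eq_square algebra_simps)
    finally show "(sqrt (real M) * (real M + 1) * 4)\<^sup>2 \<le> (2 * (2 * real M + 1) * sqrt (real M + 1))\<^sup>2" .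
  qed simp
  have "4 ^ Suc M * (real M + 1) = 4 ^ M * ((real M + 1) * 4)" by simp
  also have "\<dots> \<le> 2 * sqrt (real M) * B * ((real M + 1) * 4)"
    using step unfolding B_def by (intro mult_right_mono) auto
  also have "\<dots> = (sqrt (real M) * (real M + 1) * 4) * (2 * B)" by (simp add: mult_ac)
  also have "\<dots> \<le> (2 * (2 * real M + 1) * sqrt (real M + 1)) * (2 * B)"
    using sq by (intro mult_right_mono) (auto simp: B_def)
  also have "\<dots> = 2 * sqrt (real M + 1) * (2 * (2 * real M + 1) * B)" by (simp add: mult_ac)
  also have "\<dots> = 2 * sqrt (real M + 1) * B' * (real M + 1)" unfolding B'[symmetric] by (simp add: mult_ac)
  finally have "4 ^ Suc M \<le> 2 * sqrt (real M + 1) * B'" by (simp add: mult_le_cancel_right_pos)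
  then show ?case by (simp add: B'_def add.commute)
qed simp

section \<open>The expectation\<close>

text \<open>Term by term: \<open>lambert_term\<close> cancels the factor \<open>(1 - u)^2\<close> of the kernel and leaves a central
binomial coefficient. The factor \<open>1 / 2 + 1 / (exp t - 1) = (1 + u) / (2 (1 - u))\<close> turns the kernel
into an antisymmetric polynomial, whose central coefficient is 0, and the two differences of
exponentials have the coefficient 0 by symmetry of the kernel.\<close>
lemma circle_coeff_lambert_model:
  fixes m :: nat
  assumes \<delta>: "\<delta> > 0"
  defines "M \<equiv> m + 3" and "n \<equiv> m + 4"
  defines "\<beta> \<equiv> (of_nat ((2 * M) choose M) :: complex)"
  shows "(kernel_fps M * lambert_fps 1) $ n = \<beta>"
    and "circle_coeff M \<delta> lambert_model
           (\<beta> * (of_real (pi\<^sup>2 / 6) * (1 - 1 / (6 * of_nat n) - 1 / (20 * of_nat n * of_nat (n + 1)))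
                  - 1 / (12 * of_nat n)))"
proof -
  have n: "Suc M = n" "n = Suc M" by (simp_all add: M_def n_def)
  define k where "k i = kernel_fps M $ i" for i
  have kc: "kernel_coeff M (int (Suc M) + 0) = k n" "kernel_coeff M (int (Suc M) + 1) = k (n + 1)"
    "kernel_coeff M (int (Suc M) + - 1) = k (n - 1)" "kernel_coeff M (int (Suc M) + 2) = k (n + 2)"
    "kernel_coeff M (int (Suc M) + - 2) = k (n - 2)"
    by (simp_all add: kernel_coeff_def k_def n_def M_def nat_diff_distrib nat_add_distrib add.commute)
  have sym: "k (n + 1) = k (n - 1)" "k (n + 2) = k (n - 2)"
    and kn: "k n = - 2 * \<beta> / of_nat n"
    and k2: "2 * k (n - 1) - 2 * k n = 12 * \<beta> / (of_nat n * of_nat (n + 1))"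
    using central_kernel_coeffs[of m] by (simp_all add: k_def M_def n_def \<beta>_def)
  have "kernel_fps M * lambert_fps 1 = lambert_fps 1 * (1 - fps_X ^ 1)\<^sup>2 * (1 + fps_X) ^ (2 * M)"
    by (simp only: kernel_fps_def power_one_right mult_ac)
  also have "\<dots> = fps_X * (1 + fps_X) ^ (2 * M)"
    by (subst lambert_fps_mult) simp_all
  finally show L1: "(kernel_fps M * lambert_fps 1) $ n = \<beta>"
    unfolding n(2) by (simp add: one_plus_X_power_nth \<beta>_def)
  have c_lambert: "circle_coeff M \<delta> lambert_term \<beta>"
    using circle_coeff_lambert_term[OF \<delta>, of 1 M] L1 by (simp add: n(1))
  have c_one: "circle_coeff M \<delta> (\<lambda>t. 1) (k n)"
    using circle_coeff_exp[of M \<delta> 0] unfolding kc by simp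
  have c_exp: "circle_coeff M \<delta> (\<lambda>t. exp t) (k (n - 1))" "circle_coeff M \<delta> (\<lambda>t. exp (- t)) (k (n - 1))"
    "circle_coeff M \<delta> (\<lambda>t. exp (2 * t)) (k (n - 2))" "circle_coeff M \<delta> (\<lambda>t. exp (- 2 * t)) (k (n - 2))"
    using circle_coeff_exp[of M \<delta> 1] circle_coeff_exp[of M \<delta> "-1"] circle_coeff_exp[of M \<delta> 2]
      circle_coeff_exp[of M \<delta> "-2"] unfolding kc sym by simp_all
  have c_inv: "circle_coeff M \<delta> (\<lambda>t. 1 / (exp t - 1)) (- 1 / 2 * k n)"
  proof (rule circle_coeff_cong)
    define f :: "complex \<Rightarrow> complex" where "f u = u * inverse (1 - u)" for u
    have F: "f has_fps_expansion fps_X * inverse (1 - fps_X)"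
      unfolding f_def by (intro fps_expansion_intros) simp
    have "f holomorphic_on ball 0 1"
      unfolding f_def by (intro holomorphic_intros) auto
    from circle_coeff_power_series[OF F this \<delta>, of M]
    have "circle_coeff M \<delta> (\<lambda>t. f (exp (- t))) ((kernel_fps M * (fps_X * inverse (1 - fps_X))) $ n)"
      by (simp add: n(1))
    also have "kernel_fps M * (fps_X * inverse (1 - fps_X)) =
                 fps_X * ((1 - fps_X) * inverse (1 - fps_X) * ((1 - fps_X) * (1 + fps_X) ^ (2 * M)))"
      by (simp add: kernel_fps_def power2_eq_square mult_ac)
    also have "(1 - fps_X) * inverse (1 - fps_X) = (1 :: complex fps)"
      by (rule inverse_mult_eq_1') simp
    also have "(fps_X * (1 * ((1 - fps_X) * (1 + fps_X) ^ (2 * M)))) $ n =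
                 of_nat ((2 * M) choose (m + 3)) - (of_nat ((2 * M) choose (m + 2)) :: complex)"
      by (simp add: n_def left_diff_distrib one_plus_X_power_nth eval_nat_numeral)
    also have "\<dots> = - 1 / 2 * k n"
    proof -
      have "k n = of_nat ((2 * M) choose (m + 4)) - 2 * of_nat ((2 * M) choose (m + 3)) + of_nat ((2 * M) choose (m + 2))"
        using kernel_fps_nth[of M "m + 2"] by (simp add: k_def n_def eval_nat_numeral)
      moreover have "(2 * M) choose (m + 4) = (2 * M) choose (m + 2)"
        using binomial_symmetric[of "m + 4" "2 * M"] by (simp add: M_def)
      ultimately show ?thesis by (simp add: field_simps)
    qed
    finally show "circle_coeff M \<delta> (\<lambda>t. f (exp (- t))) (- 1 / 2 * k n)" .
    fix t assume "Re t = \<delta>"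
    then have "exp t \<noteq> 1" using \<delta> by (intro exp_neq_1_if_Re_pos) simp
    then show "f (exp (- t)) = 1 / (exp t - 1)" by (simp add: f_def exp_minus field_simps)
  qed
  define z2 :: complex where "z2 = of_real (pi\<^sup>2 / 6)"
  have "circle_coeff M \<delta>
      (\<lambda>t. z2 * ((lambert_term t + 1 / 12 * 1) - 1 / 240 * ((exp t + exp (- t)) - 2 * 1))
           - 1 / 2 * (((1 / 2 * 1 + 1 / (exp t - 1)) - 41 / 720 * (exp t - exp (- t)))
                       + 11 / 1440 * (exp (2 * t) - exp (- 2 * t))) + 1 / 24 * 1)
      (z2 * ((\<beta> + 1 / 12 * k n) - 1 / 240 * ((k (n - 1) + k (n - 1)) - 2 * k n))
           - 1 / 2 * (((1 / 2 * k n + - 1 / 2 * k n) - 41 / 720 * (k (n - 1) - k (n - 1)))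
                       + 11 / 1440 * (k (n - 2) - k (n - 2))) + 1 / 24 * k n)"
    by (intro circle_coeff_add circle_coeff_diff circle_coeff_cmult[of _ _ lambert_term]
        circle_coeff_cmult c_lambert c_one c_exp c_inv)
  also have "z2 * ((\<beta> + 1 / 12 * k n) - 1 / 240 * ((k (n - 1) + k (n - 1)) - 2 * k n))
           - 1 / 2 * (((1 / 2 * k n + - 1 / 2 * k n) - 41 / 720 * (k (n - 1) - k (n - 1)))
                       + 11 / 1440 * (k (n - 2) - k (n - 2))) + 1 / 24 * k n =
             z2 * (\<beta> + k n / 12 - (2 * k (n - 1) - 2 * k n) / 240) + k n / 24"
    by simp
  also have "\<dots> = \<beta> * (z2 * (1 - 1 / (6 * of_nat n) - 1 / (20 * of_nat n * of_nat (n + 1))) - 1 / (12 * of_nat n))"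
  proof -
    define N N' :: complex where "N = of_nat n" and "N' = of_nat (n + 1)"
    have "N \<noteq> 0" "N' \<noteq> 0" unfolding N_def N'_def of_nat_eq_0_iff by (simp_all add: n_def)
    then show ?thesis unfolding k2 unfolding kn N_def[symmetric] N'_def[symmetric] by (simp add: field_simps)
  qed
  finally show "circle_coeff M \<delta> lambert_model
           (\<beta> * (of_real (pi\<^sup>2 / 6) * (1 - 1 / (6 * of_nat n) - 1 / (20 * of_nat n * of_nat (n + 1)))
                  - 1 / (12 * of_nat n)))"
    unfolding z2_def by (rule circle_coeff_cong[rotated]) (simp add: lambert_model_def)
qed

text \<open>The terms with \<open>k > M + 1\<close> of the Lambert series start beyond the coefficient in question, so
that the infinite series may be used in place of the finite sum of \<open>sum_old_paths_eq\<close>.\<close>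
lemma circle_coeff_lambert_series:
  assumes \<delta>: "\<delta> > 0"
  shows "circle_coeff M \<delta> (\<lambda>t. \<Sum>k. lambert_term (of_nat (Suc k) * t))
           ((kernel_fps M * lambert_fps 1) $ Suc M + (\<Sum>t\<in>trees (Suc M). of_real (old_paths t)))"
proof -
  \<comment> \<open>indices are shifted by one against those of the Lambert series\<close>
  define w where "w k = (kernel_fps M * lambert_fps (Suc k)) $ Suc M" for k
  have "circle_coeff M \<delta> (\<lambda>t. \<Sum>k. lambert_term (of_nat (Suc k) * t)) (\<Sum>k. w k)"
  proof (rule circle_coeff_suminf)
    show "circle_coeff M \<delta> (\<lambda>t. lambert_term (of_nat (Suc k) * t)) (w k)" for k
      unfolding w_def by (rule circle_coeff_lambert_term[OF \<delta>]) simp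
    show "continuous_on {-pi..pi} (\<lambda>\<theta>. lambert_term (of_nat (Suc k) * circ \<delta> \<theta>))" for k
    proof -
      have "exp z + exp (- z) - 2 \<noteq> 0" if "Re z > 0" for z :: complex
        using norm_exp_sum_minus_2_ge[OF that] that by auto
      then have "exp (of_nat (Suc k) * circ \<delta> \<theta>) + exp (- (of_nat (Suc k) * circ \<delta> \<theta>)) - 2 \<noteq> 0" for \<theta>
        using \<delta> by (simp del: of_nat_Suc)
      then show ?thesis unfolding lambert_term_def by (intro continuous_intros) auto
    qed
    show "norm (lambert_term (of_nat (Suc k) * t)) \<le> 1 / (real (Suc k) * \<delta>)\<^sup>2" if "Re t = \<delta>" for k t
      using norm_lambert_term_le[of "of_nat (Suc k) * t"] that \<delta> by (simp del: of_nat_Suc)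
    show "summable (\<lambda>k. 1 / (real (Suc k) * \<delta>)\<^sup>2)" by (rule summable_inverse_Suc_square)
  qed
  also have "(\<Sum>k. w k) = (\<Sum>k<Suc (Suc M). w k)"
  proof (rule suminf_finite)
    fix k assume "k \<notin> {..<Suc (Suc M)}"
    have "kernel_fps M * lambert_fps (Suc k) =
            fps_X ^ Suc k * (kernel_fps M * inverse ((1 - fps_X ^ Suc k)\<^sup>2))"
      unfolding lambert_fps_def by (simp only: mult_ac)
    then show "w k = 0" using \<open>k \<notin> _\<close> unfolding w_def by (simp only: fps_X_power_mult_nth) simp
  qed simp
  also have "\<dots> = w 0 + (\<Sum>k<Suc M. w (Suc k))" by (rule sum.lessThan_Suc_shift)
  also have "(\<Sum>k<Suc M. w (Suc k)) = (\<Sum>t\<in>trees (Suc M). of_real (old_paths t))"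
    unfolding sum_old_paths_eq w_def by simp
  finally show ?thesis by (simp add: w_def)
qed

text \<open>The exact coefficients of the model produce \<open>n + 1\<close> in the last denominator; it is exchanged
for \<open>n\<close> only at the end.\<close>
lemma expected_old_paths_estimate:
  obtains K where "\<And>n. n \<ge> 4 \<Longrightarrow>
    \<bar>expected_old_paths n - ((pi\<^sup>2 / 6 - 1) * real n - pi\<^sup>2 / 36 - 1 / 12 - pi\<^sup>2 / (120 * (real n + 1)))\<bar>
      \<le> K / (real n)\<^sup>2"
proof -
  obtain C where "C > 0" and C: "\<And>t \<kappa>. Re t > 0 \<Longrightarrow> \<kappa> \<ge> 1 \<Longrightarrow> norm t \<le> \<kappa> * Re t \<Longrightarrow> norm t \<le> 5 \<Longrightarrow>
           norm ((\<Sum>k. lambert_term (of_nat (Suc k) * t)) - lambert_model t) \<le> C * \<kappa> ^ 8 * norm t ^ 4"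
    using lambert_series_model by blast
  define A :: real where "A = C * (4 * exp 5 * (32 ^ 8 * fact 8 * exp 1))"
  have "A > 0" using \<open>C > 0\<close> by (simp add: A_def)
  have "\<bar>expected_old_paths n - ((pi\<^sup>2 / 6 - 1) * real n - pi\<^sup>2 / 36 - 1 / 12 - pi\<^sup>2 / (120 * (real n + 1)))\<bar>
      \<le> (2 * A) / (real n)\<^sup>2" if "n \<ge> 4" for n
  proof -
    define m where "m = n - 4"
    define M where "M = m + 3"
    have n: "n = m + 4" "n = Suc M" using that by (simp_all add: m_def M_def)
    define \<delta> where "\<delta> = 1 / sqrt (real (Suc M))"
    have \<delta>: "\<delta> > 0" "\<delta> \<le> 1" by (simp_all add: \<delta>_def)
    define \<beta> where "\<beta> = real ((2 * M) choose M)"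
    have "\<beta> > 0" by (simp add: \<beta>_def)
    define T where "T = (\<Sum>t\<in>trees n. old_paths t)"
    define q where "q = pi\<^sup>2 / 6 * (1 - 1 / (6 * real n) - 1 / (20 * real n * (real n + 1))) - 1 / (12 * real n)"
    have "circle_coeff M \<delta> (\<lambda>t. \<Sum>k. lambert_term (of_nat (Suc k) * t)) (of_real \<beta> + of_real T)"
      using circle_coeff_lambert_series[OF \<delta>(1), of M] circle_coeff_lambert_model(1)[OF \<delta>(1), of m]
      by (simp add: \<beta>_def T_def n(2) M_def[symmetric] flip: n)
    moreover have "circle_coeff M \<delta> lambert_model (of_real (\<beta> * q))"
      using circle_coeff_lambert_model(2)[OF \<delta>(1), of m]
      unfolding M_def[symmetric] n(1)[symmetric] by (simp add: \<beta>_def q_def add.commute)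
    ultimately have "circle_coeff M \<delta> (\<lambda>t. (\<Sum>k. lambert_term (of_nat (Suc k) * t)) - lambert_model t)
                       (of_real \<beta> + of_real T - of_real (\<beta> * q))"
      by (rule circle_coeff_diff)
    then have "norm (of_real \<beta> + of_real T - of_real (\<beta> * q) :: complex) \<le>
                 A * 4 ^ M / (real (Suc M) ^ 3 * sqrt (real (Suc M)))"
      unfolding A_def \<delta>_def
    proof (rule circle_coeff_bound[rotated 2])
      fix \<theta> :: real assume \<theta>: "\<bar>\<theta>\<bar> \<le> pi"
      define t where "t = circ \<delta> \<theta>"
      have "norm t \<le> \<bar>Re t\<bar> + \<bar>Im t\<bar>" by (rule cmod_le)
      then have "norm t \<le> 5" using \<delta> \<theta> pi_less_4 by (simp add: t_def)
      moreover have "norm t \<ge> \<delta>" using complex_Re_le_cmod[of t] by (simp add: t_def)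
      ultimately show "norm ((\<Sum>k. lambert_term (of_nat (Suc k) * circ (1 / sqrt (real (Suc M))) \<theta>))
                - lambert_model (circ (1 / sqrt (real (Suc M))) \<theta>))
              \<le> C * (norm (circ (1 / sqrt (real (Suc M))) \<theta>) / (1 / sqrt (real (Suc M)))) ^ 8
                * norm (circ (1 / sqrt (real (Suc M))) \<theta>) ^ 4"
        unfolding \<delta>_def[symmetric] t_def[symmetric] using \<delta>
        by (intro C) (auto simp: t_def)
    qed (use \<open>C > 0\<close> in \<open>auto simp: M_def\<close>)
    moreover have "norm (of_real \<beta> + of_real T - of_real (\<beta> * q) :: complex) = \<bar>\<beta> + T - \<beta> * q\<bar>"
      by (metis norm_of_real of_real_add of_real_diff)
    ultimately have "\<bar>\<beta> + T - \<beta> * q\<bar> \<le> A * 4 ^ M / (real n ^ 3 * sqrt (real n))" by (simp add: n(2))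
    also have "\<dots> \<le> A * (2 * sqrt (real n) * \<beta>) / (real n ^ 3 * sqrt (real n))"
    proof (intro divide_right_mono mult_left_mono)
      have "4 ^ M \<le> 2 * sqrt (real M) * \<beta>" unfolding \<beta>_def by (rule central_binomial_ge) (simp add: M_def)
      also have "\<dots> \<le> 2 * sqrt (real n) * \<beta>" using n \<open>\<beta> > 0\<close> by (intro mult_right_mono mult_left_mono) auto
      finally show "4 ^ M \<le> 2 * sqrt (real n) * \<beta>" .
    qed (use \<open>A > 0\<close> in auto)
    also have "\<dots> = 2 * A * \<beta> / real n ^ 3" using n by simp
    finally have D: "\<bar>\<beta> + T - \<beta> * q\<bar> \<le> 2 * A * \<beta> / real n ^ 3" .
    have card: "real n * real (card (trees n)) = \<beta>"
      using card_trees[of M] unfolding \<beta>_def n(2) by (metis of_nat_mult)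
    have npos: "real n > 0" using n by simp
    have "expected_old_paths n = T / real (card (trees n))"
      unfolding expected_old_paths_def T_def using trees_nonempty[of n] finite_trees[of n] npos
      by (subst integral_pmf_of_set) auto
    also have "\<dots> = real n * T / \<beta>"
      using card npos \<open>\<beta> > 0\<close> by (auto simp: field_simps)
    finally have E: "expected_old_paths n = real n * T / \<beta>" .
    have target: "(pi\<^sup>2 / 6 - 1) * real n - pi\<^sup>2 / 36 - 1 / 12 - pi\<^sup>2 / (120 * (real n + 1)) = real n * (q - 1)"
    proof -
      define x y where "x = real n" and "y = real n + 1"
      have "x \<noteq> 0" "y \<noteq> 0" using npos by (simp_all add: x_def y_def)
      then show ?thesis
        unfolding q_def unfolding y_def[symmetric] unfolding x_def[symmetric] by (simp add: field_simps)
    qed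
    have "expected_old_paths n - ((pi\<^sup>2 / 6 - 1) * real n - pi\<^sup>2 / 36 - 1 / 12 - pi\<^sup>2 / (120 * (real n + 1)))
            = real n / \<beta> * (\<beta> + T - \<beta> * q)"
      unfolding E target using \<open>\<beta> > 0\<close> by (simp add: field_simps)
    then have "\<bar>expected_old_paths n - ((pi\<^sup>2 / 6 - 1) * real n - pi\<^sup>2 / 36 - 1 / 12 - pi\<^sup>2 / (120 * (real n + 1)))\<bar>
            = real n / \<beta> * \<bar>\<beta> + T - \<beta> * q\<bar>"
      using npos \<open>\<beta> > 0\<close> by (simp add: abs_mult)
    also have "\<dots> \<le> real n / \<beta> * (2 * A * \<beta> / real n ^ 3)"
      using D npos \<open>\<beta> > 0\<close> by (intro mult_left_mono) auto
    also have "\<dots> = 2 * A / (real n)\<^sup>2"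
      using npos \<open>\<beta> > 0\<close> by (simp add: field_simps eval_nat_numeral)
    finally show ?thesis .
  qed
  then show ?thesis using that by blast
qed

theorem theorem8:
  shows "(\<lambda>n::nat. expected_old_paths n
            - ((pi\<^sup>2 / 6 - 1) * real n - pi\<^sup>2 / 36 - 1 / 12 - pi\<^sup>2 / (120 * real n)))
         \<in> O(\<lambda>n. 1 / (real n)\<^sup>2)"
proof -
  obtain K where K: "\<And>n. n \<ge> 4 \<Longrightarrow>
    \<bar>expected_old_paths n - ((pi\<^sup>2 / 6 - 1) * real n - pi\<^sup>2 / 36 - 1 / 12 - pi\<^sup>2 / (120 * (real n + 1)))\<bar>
      \<le> K / (real n)\<^sup>2"
    using expected_old_paths_estimate by blast
  show ?thesis
  proof (rule bigoI[of _ "K + pi\<^sup>2 / 120"])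
    show "eventually (\<lambda>n. norm (expected_old_paths n
            - ((pi\<^sup>2 / 6 - 1) * real n - pi\<^sup>2 / 36 - 1 / 12 - pi\<^sup>2 / (120 * real n)))
             \<le> (K + pi\<^sup>2 / 120) * norm (1 / (real n)\<^sup>2)) sequentially"
      using eventually_ge_at_top[of 4]
    proof eventually_elim
      case (elim n)
      have n: "real n > 0" using elim by simp
      have "pi\<^sup>2 / (120 * real n) - pi\<^sup>2 / (120 * (real n + 1)) = pi\<^sup>2 / 120 * (1 / (real n * (real n + 1)))"
        using n by (simp add: field_simps)
      moreover have "pi\<^sup>2 / 120 * (1 / (real n * (real n + 1))) \<ge> 0" using n by simp
      moreover have "pi\<^sup>2 / 120 * (1 / (real n * (real n + 1))) \<le> pi\<^sup>2 / 120 * (1 / (real n)\<^sup>2)"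
        using n by (intro mult_left_mono divide_left_mono) (auto simp: power2_eq_square)
      ultimately have "\<bar>pi\<^sup>2 / (120 * real n) - pi\<^sup>2 / (120 * (real n + 1))\<bar> \<le> pi\<^sup>2 / 120 * (1 / (real n)\<^sup>2)"
        by linarith
      then have "\<bar>expected_old_paths n - ((pi\<^sup>2 / 6 - 1) * real n - pi\<^sup>2 / 36 - 1 / 12 - pi\<^sup>2 / (120 * real n))\<bar>
              \<le> K / (real n)\<^sup>2 + pi\<^sup>2 / 120 * (1 / (real n)\<^sup>2)"
        using K[OF elim] by linarith
      also have "\<dots> = (K + pi\<^sup>2 / 120) * (1 / (real n)\<^sup>2)" by (simp add: add_divide_distrib)
      finally show ?case by simp
    qed
  qed
qed

end
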